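(* Let $k$ be a field of characteristic $0$ with algebraic closure $\bar k$, and let $\varphi=\varphi(X,Y)\in k\langle\langle X,Y\rangle\rangle$ be a group-like element. Suppose that $\varphi$ satisfies the pentagon equation $$\varphi(t_{12},t_{23}+t_{24})\,\varphi(t_{13}+t_{23},t_{34})=\varphi(t_{23},t_{34})\,\varphi(t_{12}+t_{13},t_{24}+t_{34})\,\varphi(t_{12},t_{23})$$ in $U\mathfrak a_4$. Then there exists an element $\mu\in\bar k$, unique up to sign, such that the pair $(\mu,\varphi)$ satisfies the two hexagon equations (over $\bar k$) $$\exp\Big\{\frac{\mu (t_{13}+t_{23})}{2}\Big\}=\varphi(t_{13},t_{12})\exp\Big\{\frac{\mu t_{13}}{2}\Big\}\varphi(t_{13},t_{23})^{-1}\exp\Big\{\frac{\mu t_{23}}{2}\Big\}\varphi(t_{12},t_{23}),$$ $$\exp\Big\{\frac{\mu (t_{12}+t_{13})}{2}\Big\}=\varphi(t_{23},t_{13})^{-1}\exp\Big\{\frac{\mu t_{13}}{2}\Big\}\varphi(t_{12},t_{13})\exp\Big\{\frac{\mu t_{12}}{2}\Big\}\varphi(t_{12},t_{23})^{-1}.$$ Moreover, this $\mu$ is equal to $\pm(24c_2(\varphi))^{1/2}$.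
   Context: $k\langle\langle X,Y\rangle\rangle$ is the non-commutative formal power series ring in two variables. An element $\varphi$ of it is group-like if its constant term is $1$ and $\Delta(\varphi)=\varphi\otimes\varphi$ (completed tensor product), where $\Delta$ is the continuous algebra homomorphism with $\Delta(X)=X\otimes1+1\otimes X$ and $\Delta(Y)=Y\otimes 1+1\otimes Y$. $c_2(\varphi)\in k$ denotes the coefficient of the monomial $XY$ in $\varphi$. $\mathfrak a_4$ is the completion, with respect to the natural grading (each $t_{ij}$ in degree $1$), of the Lie algebra over $k$ with generators $t_{ij}$ ($1\le i,j\le4$) and defining relations $t_{ii}=0$, $t_{ij}=t_{ji}$, $[t_{ij},t_{ik}+t_{jk}]=0$ for $i,j,k$ all distinct, and $[t_{ij},t_{kl}]=0$ for $i,j,k,l$ all distinct. $U\mathfrak a_4$ is its degree-completed universal enveloping algebra. For elements $a,b$, $\varphi(a,b)$ denotes the image of $\varphi$ under the continuous algebra homomorphism $X\mapsto a$, $Y\mapsto b$. The hexagon equations are equations in the same completed algebra with scalars extended to $\bar k$. *)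

theory Defs
  imports
    "HOL-Library.Groups_Big_Fun"
    "HOL-Library.Poly_Mapping"
    "HOL-Library.Numeral_Type"
    "HOL-Algebra.Algebraic_Closure_Type"
begin

section \<open>Non-commutative formal power series\<close>

typedef ('a, 'b) ncps = "UNIV :: ('a list \<Rightarrow> 'b) set"
  morphisms nc_coeff Abs_ncps ..

setup_lifting type_definition_ncps

lemma ncps_eqI: "(\<And>w. nc_coeff f w = nc_coeff g w) \<Longrightarrow> f = g"
  by (simp add: nc_coeff_inject[symmetric] fun_eq_iff)

lemma nc_coeff_Abs [simp]: "nc_coeff (Abs_ncps f) = f"
  by (simp add: Abs_ncps_inverse)

instantiation ncps :: (type, ring_1) ring_1
begin

lift_definition zero_ncps :: "('a, 'b) ncps" is "\<lambda>_. 0" .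
lift_definition one_ncps :: "('a, 'b) ncps" is "\<lambda>w. if w = [] then 1 else 0" .
lift_definition plus_ncps :: "('a, 'b) ncps \<Rightarrow> ('a, 'b) ncps \<Rightarrow> ('a, 'b) ncps"
  is "\<lambda>f g w. f w + g w" .
lift_definition minus_ncps :: "('a, 'b) ncps \<Rightarrow> ('a, 'b) ncps \<Rightarrow> ('a, 'b) ncps"
  is "\<lambda>f g w. f w - g w" .
lift_definition uminus_ncps :: "('a, 'b) ncps \<Rightarrow> ('a, 'b) ncps"
  is "\<lambda>f w. - f w" .
lift_definition times_ncps :: "('a, 'b) ncps \<Rightarrow> ('a, 'b) ncps \<Rightarrow> ('a, 'b) ncps"
  is "\<lambda>f g w. \<Sum>i\<le>length w. f (take i w) * g (drop i w)" .

instance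
proof
  fix f g h :: "('a, 'b) ncps"
  show "f * g * h = f * (g * h)"
  proof (transfer, rule ext)
    fix f g h :: "'a list \<Rightarrow> 'b" and w :: "'a list"
    let ?n = "length w"
    have "(\<Sum>i\<le>?n. (\<Sum>j\<le>length (take i w). f (take j (take i w)) * g (drop j (take i w))) * h (drop i w))
        = (\<Sum>i\<le>?n. \<Sum>j\<le>i. f (take j w) * g (drop j (take i w)) * h (drop i w))"
      by (intro sum.cong) (auto simp: sum_distrib_right min_def)
    also have "\<dots> = (\<Sum>(i, j)\<in>Sigma {..?n} (\<lambda>i. {..i}).
        f (take j w) * g (drop j (take i w)) * h (drop i w))"
      by (simp add: sum.Sigma)
    also have "\<dots> = (\<Sum>(j, m)\<in>Sigma {..?n} (\<lambda>j. {..?n - j}).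
        f (take j w) * g (take m (drop j w)) * h (drop m (drop j w)))"
      by (rule sum.reindex_bij_witness[of _ "\<lambda>(j, m). (j + m, j)" "\<lambda>(i, j). (j, i - j)"])
         (auto simp: drop_take add.commute)
    also have "\<dots> = (\<Sum>j\<le>?n. \<Sum>m\<le>?n - j. f (take j w) * g (take m (drop j w)) * h (drop m (drop j w)))"
      by (simp add: sum.Sigma)
    also have "\<dots> = (\<Sum>j\<le>?n. f (take j w) *
        (\<Sum>m\<le>length (drop j w). g (take m (drop j w)) * h (drop m (drop j w))))"
      by (simp add: sum_distrib_left mult.assoc)
    finally show "(\<Sum>i\<le>?n. (\<Sum>j\<le>length (take i w). f (take j (take i w)) * g (drop j (take i w))) * h (drop i w))
        = (\<Sum>j\<le>?n. f (take j w) *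
        (\<Sum>m\<le>length (drop j w). g (take m (drop j w)) * h (drop m (drop j w))))" .
  qed
  show "1 * f = f"
  proof (transfer, rule ext)
    fix f :: "'a list \<Rightarrow> 'b" and w :: "'a list"
    have "(\<Sum>i\<le>length w. (if take i w = [] then 1 else 0) * f (drop i w))
        = (\<Sum>i\<le>length w. if i = 0 then f w else 0)"
      by (intro sum.cong) auto
    then show "(\<Sum>i\<le>length w. (if take i w = [] then 1 else 0) * f (drop i w)) = f w"
      by simp
  qed
  show "f * 1 = f"
  proof (transfer, rule ext)
    fix f :: "'a list \<Rightarrow> 'b" and w :: "'a list"
    have "(\<Sum>i\<le>length w. f (take i w) * (if drop i w = [] then 1 else 0))
        = (\<Sum>i\<le>length w. if i = length w then f w else 0)"
      by (intro sum.cong) auto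
    then show "(\<Sum>i\<le>length w. f (take i w) * (if drop i w = [] then 1 else 0)) = f w"
      by simp
  qed
  show "(f + g) * h = f * h + g * h"
    by transfer (simp add: algebra_simps sum.distrib)
  show "f * (g + h) = f * g + f * h"
    by transfer (simp add: algebra_simps sum.distrib)
  show "(0 :: ('a, 'b) ncps) \<noteq> 1"
    by transfer (auto simp: fun_eq_iff)
qed (transfer; simp add: algebra_simps)+

end

definition nc_var :: "'a \<Rightarrow> ('a, 'b::ring_1) ncps" where
  "nc_var x = Abs_ncps (\<lambda>w. if w = [x] then 1 else 0)"

definition nc_smult :: "'b::ring_1 \<Rightarrow> ('a, 'b) ncps \<Rightarrow> ('a, 'b) ncps" where
  "nc_smult c f = Abs_ncps (\<lambda>w. c * nc_coeff f w)"

definition nc_map :: "('b \<Rightarrow> 'c) \<Rightarrow> ('a, 'b) ncps \<Rightarrow> ('a, 'c) ncps" where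
  "nc_map h f = Abs_ncps (h \<circ> nc_coeff f)"

definition nc_inv :: "('a, 'b::ring_1) ncps \<Rightarrow> ('a, 'b) ncps" where
  "nc_inv f = (THE g. f * g = 1 \<and> g * f = 1)"

text \<open>
  Infinite sums of series are taken coefficientwise, with \<^const>\<open>Sum_any\<close> summing a family of
  scalars that has finite support. The families below have finite support as soon as the series
  that are substituted or exponentiated have constant term \<open>0\<close>
  (see \<open>finite_support_nc_exp\<close> and \<open>finite_support_nc_eval\<close>).
\<close>

definition nc_exp :: "('a, 'b::field_char_0) ncps \<Rightarrow> ('a, 'b) ncps" where
  "nc_exp f = Abs_ncps (\<lambda>w. Sum_any (\<lambda>n. nc_coeff (f ^ n) w / fact n))"

datatype xy = LX | LY

primrec word_eval :: "('a, 'b::ring_1) ncps \<Rightarrow> ('a, 'b) ncps \<Rightarrow> xy list \<Rightarrow> ('a, 'b) ncps" where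
  "word_eval a b [] = 1"
| "word_eval a b (z # v) = (case z of LX \<Rightarrow> a | LY \<Rightarrow> b) * word_eval a b v"

definition nc_eval ::
    "(xy, 'b::ring_1) ncps \<Rightarrow> ('a, 'b) ncps \<Rightarrow> ('a, 'b) ncps \<Rightarrow> ('a, 'b) ncps" where
  "nc_eval \<phi> a b = Abs_ncps (\<lambda>w. Sum_any (\<lambda>v. nc_coeff \<phi> v * nc_coeff (word_eval a b v) w))"

definition c2 :: "(xy, 'b) ncps \<Rightarrow> 'b" where
  "c2 \<phi> = nc_coeff \<phi> [LX, LY]"


subsection \<open>Finiteness of the sums and existence of inverses\<close>

lemma nc_coeff_mult:
  "nc_coeff (f * g) w = (\<Sum>i\<le>length w. nc_coeff f (take i w) * nc_coeff g (drop i w))"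
  by transfer simp

lemma nc_coeff_mult_order:
  assumes "nc_coeff f [] = 0" "\<And>u. length u < n \<Longrightarrow> nc_coeff g u = 0" "length w < Suc n"
  shows "nc_coeff (f * g) w = 0"
  unfolding nc_coeff_mult
proof (intro sum.neutral ballI)
  fix i assume "i \<in> {..length w}"
  then show "nc_coeff f (take i w) * nc_coeff g (drop i w) = 0"
    using assms by (cases "i = 0") auto
qed

lemma nc_coeff_power_order:
  assumes "nc_coeff f [] = 0" "length w < n"
  shows "nc_coeff (f ^ n) w = 0"
  using assms(2)
proof (induction n arbitrary: w)
  case (Suc n)
  then show ?case using assms(1) by (auto intro: nc_coeff_mult_order)
qed simp

lemma nc_coeff_word_eval_order:
  assumes "nc_coeff a [] = 0" "nc_coeff b [] = 0" "length w < length v"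
  shows "nc_coeff (word_eval a b v) w = 0"
  using assms(3)
proof (induction v arbitrary: w)
  case (Cons z v)
  then show ?case
    using assms(1,2) by (auto split: xy.split intro!: nc_coeff_mult_order[where n = "length v"])
qed simp

lemma finite_UNIV_xy: "finite (UNIV :: xy set)"
proof -
  have "(UNIV :: xy set) = {LX, LY}" using xy.exhaust by auto
  then show ?thesis by (metis finite.simps)
qed

lemma finite_xy_words: "finite {v :: xy list. length v \<le> n}"
  using finite_lists_length_le[OF finite_UNIV_xy, of n] by simp

lemma finite_support_nc_exp:
  assumes "nc_coeff f [] = 0"
  shows "finite {n. nc_coeff (f ^ n) w / fact n \<noteq> (0 :: 'b::field_char_0)}"
  by (rule finite_subset[of _ "{..length w}"])
     (use assms nc_coeff_power_order[of f w] in \<open>auto simp: not_le[symmetric]\<close>)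

lemma finite_support_nc_eval:
  assumes "nc_coeff a [] = 0" "nc_coeff b [] = 0"
  shows "finite {v. nc_coeff \<phi> v * nc_coeff (word_eval a b v) w \<noteq> 0}"
  by (rule finite_subset[OF _ finite_xy_words[of "length w"]])
     (use assms nc_coeff_word_eval_order[of a b w] in \<open>force simp: not_le[symmetric]\<close>)

lemma nc_inverse_exists:
  fixes f :: "('a, 'b::ring_1) ncps"
  assumes "nc_coeff f [] = 1"
  shows "f * nc_inv f = 1 \<and> nc_inv f * f = 1"
proof -
  define z where "z = 1 - f"
  have z0: "nc_coeff z [] = 0"
    using assms by (simp add: z_def minus_ncps.rep_eq one_ncps.rep_eq)
  define S where "S = (\<lambda>N. \<Sum>n\<le>N. z ^ n)"
  have S_stable: "nc_coeff (S N) w = nc_coeff (S (length w)) w" if "length w \<le> N" for N w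
    using that
  proof (induction N rule: dec_induct)
    case (step m)
    then show ?case
      using nc_coeff_power_order[OF z0, of w "Suc m"]
      by (simp add: S_def plus_ncps.rep_eq del: power_Suc)
  qed simp
  define g where "g = Abs_ncps (\<lambda>w. nc_coeff (S (length w)) w)"
  have g_S: "nc_coeff g u = nc_coeff (S N) u" if "length u \<le> N" for u N
    using S_stable[OF that] by (simp add: g_def)
  have fS: "f * S N = 1 - z ^ Suc N" for N
  proof (induction N)
    case (Suc N)
    have "f * S (Suc N) = f * S N + (1 - z) * z ^ Suc N"
      by (simp add: S_def z_def ring_distribs)
    then show ?case using Suc.IH by (simp add: algebra_simps)
  qed (simp add: S_def z_def)
  have Sf: "S N * f = 1 - z ^ Suc N" for N
  proof (induction N)
    case (Suc N)
    have "S (Suc N) * f = S N * f + z ^ Suc N * (1 - z)"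
      by (simp add: S_def z_def ring_distribs)
    then show ?case using Suc.IH by (simp add: algebra_simps power_commutes)
  qed (simp add: S_def z_def)
  have 1: "f * g = 1"
  proof (rule ncps_eqI)
    fix w
    have "nc_coeff (f * g) w = nc_coeff (f * S (length w)) w"
      unfolding nc_coeff_mult by (intro sum.cong refl) (simp add: g_S[where N = "length w"])
    then show "nc_coeff (f * g) w = nc_coeff 1 w"
      using nc_coeff_power_order[OF z0, of w "Suc (length w)"]
      by (simp add: fS minus_ncps.rep_eq del: power_Suc)
  qed
  have 2: "g * f = 1"
  proof (rule ncps_eqI)
    fix w
    have "nc_coeff (g * f) w = nc_coeff (S (length w) * f) w"
      unfolding nc_coeff_mult by (intro sum.cong refl) (simp add: g_S[where N = "length w"])
    then show "nc_coeff (g * f) w = nc_coeff 1 w"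
      using nc_coeff_power_order[OF z0, of w "Suc (length w)"]
      by (simp add: Sf minus_ncps.rep_eq del: power_Suc)
  qed
  show ?thesis
    unfolding nc_inv_def
  proof (rule theI)
    show "f * g = 1 \<and> g * f = 1" using 1 2 by simp
    show "h = g" if "f * h = 1 \<and> h * f = 1" for h
      by (metis that 1 mult.assoc mult_1_left mult_1_right)
  qed
qed

lemma nc_coeff_nc_eval_Nil:
  assumes "nc_coeff a [] = 0" "nc_coeff b [] = 0"
  shows "nc_coeff (nc_eval \<phi> a b) [] = nc_coeff \<phi> []"
proof -
  have "{v. nc_coeff \<phi> v * nc_coeff (word_eval a b v) [] \<noteq> 0} \<subseteq> {[]}"
    using assms nc_coeff_word_eval_order[of a b "[]"] by force
  then show ?thesis
    by (simp add: nc_eval_def Sum_any.expand_superset[of "{[]}"] one_ncps.rep_eq)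
qed


section \<open>Group-like series\<close>

text \<open>
  An element of the completed tensor square of the series ring is given by its coefficients
  at the pure tensors of words.
\<close>

type_synonym 'b xy_tensor = "xy list \<times> xy list \<Rightarrow> 'b"

definition tensor :: "(xy, 'b::ring_1) ncps \<Rightarrow> (xy, 'b) ncps \<Rightarrow> 'b xy_tensor" where
  "tensor f g = (\<lambda>(u, v). nc_coeff f u * nc_coeff g v)"

definition tensor_mult :: "'b::ring_1 xy_tensor \<Rightarrow> 'b xy_tensor \<Rightarrow> 'b xy_tensor" where
  "tensor_mult F G = (\<lambda>(u, v). \<Sum>i\<le>length u. \<Sum>j\<le>length v.
     F (take i u, take j v) * G (drop i u, drop j v))"

primrec Delta_word :: "xy list \<Rightarrow> 'b::ring_1 xy_tensor" where
  "Delta_word [] = tensor 1 1"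
| "Delta_word (z # w) =
     tensor_mult (\<lambda>uv. tensor (nc_var z) 1 uv + tensor 1 (nc_var z) uv) (Delta_word w)"

lemma Delta_word_homogeneous:
  "length u + length v \<noteq> length w \<Longrightarrow> Delta_word w (u, v) = (0 :: 'b::ring_1)"
proof (induction w arbitrary: u v)
  case Nil
  then show ?case by (auto simp: tensor_def one_ncps.rep_eq)
next
  case (Cons z w)
  show ?case
    unfolding Delta_word.simps tensor_mult_def prod.case
  proof (intro sum.neutral ballI)
    fix i j assume ij: "i \<in> {..length u}" "j \<in> {..length v}"
    show "(tensor (nc_var z) 1 (take i u, take j v) + tensor 1 (nc_var z) (take i u, take j v)) *
        Delta_word w (drop i u, drop j v) = (0 :: 'b)"
    proof (cases "i + j = 1")
      case True
      then have "length (drop i u) + length (drop j v) \<noteq> length w"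
        using ij Cons.prems by auto
      then have "Delta_word w (drop i u, drop j v) = (0 :: 'b)"
        by (rule Cons.IH)
      then show ?thesis by simp
    next
      case False
      have "tensor (nc_var z) 1 (take i u, take j v) = (0 :: 'b)"
           "tensor 1 (nc_var z) (take i u, take j v) = (0 :: 'b)"
        using False ij
        by (auto simp: tensor_def nc_var_def one_ncps.rep_eq dest!: arg_cong[where f = length])
      then show ?thesis by simp
    qed
  qed
qed

lemma finite_support_Delta:
  "finite {w. nc_coeff \<phi> w * Delta_word w (u, v) \<noteq> (0 :: 'b::ring_1)}"
proof (rule finite_subset[OF _ finite_xy_words[of "length u + length v"]], clarify)
  fix w assume "nc_coeff \<phi> w * Delta_word w (u, v) \<noteq> (0 :: 'b)"
  then have "Delta_word w (u, v) \<noteq> (0 :: 'b)" by auto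
  then show "length w \<le> length u + length v"
    using Delta_word_homogeneous[of u v w] by force
qed

definition Delta :: "(xy, 'b::ring_1) ncps \<Rightarrow> 'b xy_tensor" where
  "Delta \<phi> = (\<lambda>uv. Sum_any (\<lambda>w. nc_coeff \<phi> w * Delta_word w uv))"

definition group_like :: "(xy, 'b::ring_1) ncps \<Rightarrow> bool" where
  "group_like \<phi> \<longleftrightarrow> nc_coeff \<phi> [] = 1 \<and> Delta \<phi> = tensor \<phi> \<phi>"


section \<open>Lie algebras given by generators and relations\<close>

text \<open>
  The free Lie algebra on \<open>'g\<close> is the free non-associative algebra on \<open>'g\<close>, that is the space of
  finitely supported functions on the free magma, modulo the ideal generated by all \<open>[p, p]\<close> and
  all Jacobi expressions. Imposing further relations enlarges the ideal.
\<close>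

datatype 'g magma = Gen 'g | Br "'g magma" "'g magma"

type_synonym ('g, 'k) nonassoc = "'g magma \<Rightarrow>\<^sub>0 'k"

definition na_smult :: "'k::field \<Rightarrow> ('g, 'k) nonassoc \<Rightarrow> ('g, 'k) nonassoc" where
  "na_smult c p = Poly_Mapping.map ((*) c) p"

definition na_bracket :: "('g, 'k::field) nonassoc \<Rightarrow> ('g, 'k) nonassoc \<Rightarrow> ('g, 'k) nonassoc" where
  "na_bracket p q = (\<Sum>x\<in>Poly_Mapping.keys p. \<Sum>y\<in>Poly_Mapping.keys q.
     Poly_Mapping.single (Br x y) (Poly_Mapping.lookup p x * Poly_Mapping.lookup q y))"

definition na_ideal :: "('g, 'k::field) nonassoc set \<Rightarrow> bool" where
  "na_ideal I \<longleftrightarrow> 0 \<in> I \<and> (\<forall>p\<in>I. \<forall>q\<in>I. p + q \<in> I) \<and> (\<forall>c. \<forall>p\<in>I. na_smult c p \<in> I) \<and>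
     (\<forall>p\<in>I. \<forall>q. na_bracket p q \<in> I \<and> na_bracket q p \<in> I)"

definition lie_axioms :: "('g, 'k::field) nonassoc set" where
  "lie_axioms = {na_bracket p p | p. True} \<union>
     {na_bracket p (na_bracket q r) + na_bracket q (na_bracket r p) + na_bracket r (na_bracket p q)
      | p q r. True}"

definition lie_ideal :: "('g, 'k::field) nonassoc set \<Rightarrow> ('g, 'k) nonassoc set" where
  "lie_ideal R = na_ideal hull (lie_axioms \<union> R)"


section \<open>Completed universal enveloping algebras\<close>

text \<open>
  Let \<open>L\<close> be the Lie algebra presented by the generators \<open>'g\<close> and the relators \<open>R\<close>. Its tensor
  algebra is the algebra of non-commutative polynomials in the elements of the free magma, modulo
  the two-sided ideal generated by \<^term>\<open>lie_ideal R\<close>. The enveloping algebra imposes in addition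
  \<open>[p, q] = p q - q p\<close>. If \<open>'g\<close> is finite and \<open>R\<close> homogeneous, the degree completion is obtained by
  passing to power series and to the closure of the ideal, where a letter has as degree the number
  of generators in it.
\<close>

primrec magma_degree :: "'g magma \<Rightarrow> nat" where
  "magma_degree (Gen g) = 1"
| "magma_degree (Br x y) = magma_degree x + magma_degree y"

definition word_degree :: "'g magma list \<Rightarrow> nat" where
  "word_degree w = sum_list (map magma_degree w)"

type_synonym ('g, 'k) env_series = "('g magma, 'k) ncps"

definition env_of_lie :: "('g, 'k::field) nonassoc \<Rightarrow> ('g, 'k) env_series" where
  "env_of_lie p = Abs_ncps (\<lambda>w. case w of [x] \<Rightarrow> Poly_Mapping.lookup p x | _ \<Rightarrow> 0)"

definition closed_ideal :: "('g, 'k::field) env_series set \<Rightarrow> bool" where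
  "closed_ideal I \<longleftrightarrow> 0 \<in> I \<and> (\<forall>f\<in>I. \<forall>g\<in>I. f + g \<in> I) \<and> (\<forall>f\<in>I. \<forall>g. f * g \<in> I \<and> g * f \<in> I) \<and>
     (\<forall>f. (\<forall>n. \<exists>g\<in>I. \<forall>w. word_degree w \<le> n \<longrightarrow> nc_coeff f w = nc_coeff g w) \<longrightarrow> f \<in> I)"

definition env_ideal :: "('g, 'k::field) nonassoc set \<Rightarrow> ('g, 'k) env_series set" where
  "env_ideal R = closed_ideal hull
     (env_of_lie ` lie_ideal R \<union>
      {env_of_lie (na_bracket p q) - (env_of_lie p * env_of_lie q - env_of_lie q * env_of_lie p)
       | p q. True})"


section \<open>The algebra \<open>U\<aa>\<^sub>4\<close>\<close>

text \<open>Indices are taken in the four-element type \<open>4\<close>, whose elements are \<open>1, 2, 3\<close> and \<open>4 = 0\<close>.\<close>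

lemma distinct_4: "distinct [1, 2, 3, 4 :: 4]"
  by simp

lemma UNIV_4: "(UNIV :: 4 set) = {1, 2, 3, 4}"
proof -
  have "card {1, 2, 3, 4 :: 4} = CARD(4)"
    using distinct_card[OF distinct_4] by simp
  then show ?thesis
    by (metis card_subset_eq finite_UNIV subset_UNIV finite)
qed

definition t_lie :: "4 \<Rightarrow> 4 \<Rightarrow> (4 \<times> 4, 'k::field) nonassoc" where
  "t_lie i j = Poly_Mapping.single (Gen (i, j)) 1"

definition a4_relators :: "(4 \<times> 4, 'k::field) nonassoc set" where
  "a4_relators = {t_lie i i | i. True} \<union> {t_lie i j - t_lie j i | i j. True} \<union>
     {na_bracket (t_lie i j) (t_lie i k + t_lie j k) | i j k. distinct [i, j, k]} \<union>
     {na_bracket (t_lie i j) (t_lie k l) | i j k l. distinct [i, j, k, l]}"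

definition t :: "4 \<Rightarrow> 4 \<Rightarrow> (4 \<times> 4, 'k::field) env_series" where
  "t i j = env_of_lie (t_lie i j)"

text \<open>
  An element of \<open>U\<aa>\<^sub>4\<close> is represented by a series; \<open>x \<doteq> y\<close> says that \<open>x\<close> and \<open>y\<close> represent the
  same element of \<open>U\<aa>\<^sub>4\<close>. Products, substitutions, inverses and exponentials can be formed on
  representatives, as the quotient map is a continuous ring homomorphism.
\<close>

definition Ua4_eq :: "(4 \<times> 4, 'k::field) env_series \<Rightarrow> (4 \<times> 4, 'k) env_series \<Rightarrow> bool"
    (infix \<open>\<doteq>\<close> 50) where
  "x \<doteq> y \<longleftrightarrow> x - y \<in> env_ideal a4_relators"

definition pentagon :: "(xy, 'k::field) ncps \<Rightarrow> bool" where
  "pentagon \<phi> \<longleftrightarrow>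
     nc_eval \<phi> (t 1 2) (t 2 3 + t 2 4) * nc_eval \<phi> (t 1 3 + t 2 3) (t 3 4) \<doteq>
     nc_eval \<phi> (t 2 3) (t 3 4) * nc_eval \<phi> (t 1 2 + t 1 3) (t 2 4 + t 3 4) * nc_eval \<phi> (t 1 2) (t 2 3)"

definition hexagon1 :: "'k::field_char_0 \<Rightarrow> (xy, 'k) ncps \<Rightarrow> bool" where
  "hexagon1 \<mu> \<phi> \<longleftrightarrow>
     nc_exp (nc_smult (\<mu> / 2) (t 1 3 + t 2 3)) \<doteq>
     nc_eval \<phi> (t 1 3) (t 1 2) * nc_exp (nc_smult (\<mu> / 2) (t 1 3)) *
     nc_inv (nc_eval \<phi> (t 1 3) (t 2 3)) * nc_exp (nc_smult (\<mu> / 2) (t 2 3)) *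
     nc_eval \<phi> (t 1 2) (t 2 3)"

definition hexagon2 :: "'k::field_char_0 \<Rightarrow> (xy, 'k) ncps \<Rightarrow> bool" where
  "hexagon2 \<mu> \<phi> \<longleftrightarrow>
     nc_exp (nc_smult (\<mu> / 2) (t 1 2 + t 1 3)) \<doteq>
     nc_inv (nc_eval \<phi> (t 2 3) (t 1 3)) * nc_exp (nc_smult (\<mu> / 2) (t 1 3)) *
     nc_eval \<phi> (t 1 2) (t 1 3) * nc_exp (nc_smult (\<mu> / 2) (t 1 2)) *
     nc_inv (nc_eval \<phi> (t 1 2) (t 2 3))"

end

theory Submission
  imports Defs "HOL-Computational_Algebra.Formal_Power_Series"
begin

text \<open>A homomorphism from \<open>U\<aa>\<^sub>4\<close> to any ring turns the pentagon equation into an identity there, and a few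
  homomorphisms suffice. Sending \<open>t\<^sub>1\<^sub>2\<close> or \<open>t\<^sub>3\<^sub>4\<close> to \<open>1\<close> and the other generators to \<open>0\<close> shows that \<open>\<phi>\<close> has no
  pure powers, so that by group-likeness \<open>\<phi>(a, b) = 1\<close> when \<open>a\<close> and \<open>b\<close> commute and \<open>\<phi>(a, b)\<close> does
  not change when a central element is added to an argument; a further one yields \<open>\<phi>(b, a) \<phi>(a, b) = 1\<close>.

  Modulo the central element \<open>t\<^sub>1\<^sub>2 + t\<^sub>1\<^sub>3 + t\<^sub>2\<^sub>3\<close> both hexagon equations become the vanishing of one series
  \<open>D(X, Y)\<close>. Moving strand 4 past strands 1, 2, 3 in two ways and comparing the results by four
  permuted pentagon equations shows that the lowest-degree part \<open>r\<close> of \<open>D\<close> satisfies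
  \<open>r(x + y, z) + r(x, y) = r(x, y + z) + r(y, z)\<close> for \<open>x = t\<^sub>1\<^sub>4\<close>, \<open>y = t\<^sub>2\<^sub>4\<close>, \<open>z = t\<^sub>3\<^sub>4\<close>, and these generate a free
  algebra: \<open>U\<aa>\<^sub>4\<close> acts on functions on words in three letters. Comparing coefficients, \<open>r\<close>
  vanishes on powers of a letter and, in degree at least 3, is constant on the other words. As
  \<open>D(1, 1) = 0\<close>, this constant is 0. Thus the only obstruction lies in degree 2, where it is
  \<open>(\<mu>\<^sup>2 / 8 - 3 c\<^sub>2(\<phi>)) [X, Y]\<close>.\<close>

lemmas nc_coeff_simps = zero_ncps.rep_eq one_ncps.rep_eq plus_ncps.rep_eq minus_ncps.rep_eq
  uminus_ncps.rep_eq

section \<open>Graded evaluation of series\<close>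

definition wprod :: "('a \<Rightarrow> 'r::ring_1) \<Rightarrow> 'a list \<Rightarrow> 'r" where
  "wprod \<theta> w = prod_list (map \<theta> w)"

lemma wprod_simps [simp]:
  "wprod \<theta> [] = 1" "wprod \<theta> (x # w) = \<theta> x * wprod \<theta> w" "wprod \<theta> (u @ v) = wprod \<theta> u * wprod \<theta> v"
  by (simp_all add: wprod_def)

definition wdeg :: "('a \<Rightarrow> nat) \<Rightarrow> 'a list \<Rightarrow> nat" where
  "wdeg d w = sum_list (map d w)"

lemma wdeg_simps [simp]:
  "wdeg d [] = 0" "wdeg d (x # w) = d x + wdeg d w" "wdeg d (u @ v) = wdeg d u + wdeg d v"
  by (simp_all add: wdeg_def)

lemma wdeg_one [simp]: "wdeg (\<lambda>_. Suc 0) w = length w"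
  by (induction w) auto

text \<open>Evaluation at \<open>\<theta>\<close>, with the part of degree \<open>n\<close> kept apart as the \<open>n\<close>-th coefficient, so that
  no topology on the target ring is needed.\<close>

definition gev ::
    "('k \<Rightarrow> 'r::ring_1) \<Rightarrow> ('a \<Rightarrow> nat) \<Rightarrow> ('a \<Rightarrow> 'r) \<Rightarrow> ('a, 'k) ncps \<Rightarrow> 'r fps" where
  "gev sc d \<theta> f = Abs_fps (\<lambda>n. \<Sum>w | wdeg d w = n. sc (nc_coeff f w) * wprod \<theta> w)"

text \<open>The monomial \<open>a\<close> T^n, where T is the variable of \<open>fps\<close>: a
  homogeneous element together with its degree.\<close>

definition hm :: "nat \<Rightarrow> 'r::ring_1 \<Rightarrow> 'r fps" where
  "hm n a = Abs_fps (\<lambda>i. if i = n then a else 0)"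

lemma hm_nth [simp]: "fps_nth (hm n a) i = (if i = n then a else 0)"
  by (simp add: hm_def)

lemma hm_mult: "hm m a * hm n b = hm (m + n) (a * b)"
proof (rule fps_ext)
  fix i
  have "fps_nth (hm m a * hm n b) i = (\<Sum>j=0..i. if j = m then (if i - j = n then a * b else 0) else 0)"
    unfolding fps_mult_nth by (intro sum.cong) auto
  also have "\<dots> = fps_nth (hm (m + n) (a * b)) i"
    by (auto simp: sum.delta)
  finally show "fps_nth (hm m a * hm n b) i = fps_nth (hm (m + n) (a * b)) i" .
qed

lemma hm_0_1: "hm 0 1 = 1"
  by (rule fps_ext) simp

lemma hm_power: "hm m a ^ n = hm (m * n) (a ^ n)"
  by (induction n) (auto simp: hm_mult hm_0_1)

lemma hm_add: "hm n (a + b) = hm n a + hm n b"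
  by (rule fps_ext) simp

lemma hm_diff: "hm n (a - b) = hm n a - hm n b"
  by (rule fps_ext) simp

lemma hm_minus: "hm n (- a) = - hm n a"
  by (rule fps_ext) simp

lemma hm_0: "hm n 0 = 0"
  by (rule fps_ext) simp

text \<open>A \<open>'k\<close>-algebra structure on \<open>'r\<close>, given by its structure map
  into the centre. As an explicit parameter it lets the same ring be an algebra over two
  fields.\<close>

locale algebra_map =
  fixes sc :: "'k::field \<Rightarrow> 'r::ring_1"
  assumes sc_add: "sc (a + b) = sc a + sc b"
    and sc_mult: "sc (a * b) = sc a * sc b"
    and sc_one: "sc 1 = 1"
    and sc_central: "sc a * x = x * sc a"
begin

lemma sc_zero: "sc 0 = 0"
  using sc_add[of 0 0] by simp

lemma sc_minus: "sc (- a) = - sc a"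
  using sc_add[of a "- a"] by (simp add: sc_zero eq_neg_iff_add_eq_0 add.commute)

lemma sc_diff: "sc (a - b) = sc a - sc b"
  using sc_add[of a "- b"] by (simp add: sc_minus)

lemma sc_sum: "sc (sum f A) = (\<Sum>x\<in>A. sc (f x))"
  by (induction A rule: infinite_finite_induct) (auto simp: sc_add sc_zero)

lemma sc_left_commute: "x * (sc a * y) = sc a * (x * y)"
  by (metis sc_central mult.assoc)

end

lemma Sum_any_superset_0:
  assumes "finite A" "\<And>v. v \<notin> A \<Longrightarrow> f v = 0"
  shows "Sum_any f = sum f A"
  by (rule Sum_any.expand_superset) (use assms in auto)

text \<open>Positive degrees and finitely many letters in each degree leave finitely many words of
  each total degree, so the sums in \<open>gev\<close> are finite.\<close>

locale graded_algebra_map = algebra_map sc for sc :: "'k::field \<Rightarrow> 'r::ring_1" +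
  fixes d :: "'a \<Rightarrow> nat"
  assumes d_pos: "0 < d x" and finite_d: "finite {x. d x = n}"
begin

lemma length_le_wdeg: "length w \<le> wdeg d w"
proof (induction w)
  case (Cons x w)
  then show ?case using d_pos[of x] by simp
qed simp

lemma letter_le_wdeg: "x \<in> set w \<Longrightarrow> d x \<le> wdeg d w"
  by (induction w) auto

lemma finite_letters: "finite {x. d x \<le> n}"
proof -
  have "{x. d x \<le> n} = (\<Union>m\<le>n. {x. d x = m})" by auto
  then show ?thesis using finite_d by simp
qed

lemma finite_words: "finite {w. wdeg d w = n}"
  by (rule finite_subset[OF _ finite_lists_length_le[OF finite_letters[of n], of n]])
     (use length_le_wdeg letter_le_wdeg in auto)

lemma gev_nth: "fps_nth (gev sc d \<theta> f) n = (\<Sum>w | wdeg d w = n. sc (nc_coeff f w) * wprod \<theta> w)"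
  by (simp add: gev_def)

lemma wdeg_0_iff [simp]: "wdeg d w = 0 \<longleftrightarrow> w = []"
  using length_le_wdeg[of w] by auto

lemma gev_nth_0: "fps_nth (gev sc d \<theta> f) 0 = sc (nc_coeff f [])"
  by (simp add: gev_nth)

lemma gev_add: "gev sc d \<theta> (f + g) = gev sc d \<theta> f + gev sc d \<theta> g"
  by (rule fps_ext) (simp add: gev_nth nc_coeff_simps sc_add distrib_right sum.distrib)

lemma gev_minus: "gev sc d \<theta> (- f) = - gev sc d \<theta> f"
  by (rule fps_ext) (simp add: gev_nth nc_coeff_simps sc_minus sum_negf)

lemma gev_diff: "gev sc d \<theta> (f - g) = gev sc d \<theta> f - gev sc d \<theta> g"
  by (rule fps_ext) (simp add: gev_nth nc_coeff_simps sc_diff left_diff_distrib sum_subtractf)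

lemma gev_0: "gev sc d \<theta> 0 = 0"
  by (rule fps_ext) (simp add: gev_nth nc_coeff_simps sc_zero)

lemma gev_1: "gev sc d \<theta> 1 = 1"
proof (rule fps_ext)
  fix n
  have "fps_nth (gev sc d \<theta> 1) n = (\<Sum>w | wdeg d w = n. if w = [] then 1 else 0)"
    unfolding gev_nth by (intro sum.cong) (auto simp: nc_coeff_simps sc_zero sc_one)
  then show "fps_nth (gev sc d \<theta> 1) n = fps_nth 1 n"
    by (auto simp: sum.delta finite_words)
qed

lemma gev_smult: "gev sc d \<theta> (nc_smult c f) = fps_const (sc c) * gev sc d \<theta> f"
  by (rule fps_ext) (simp add: gev_nth nc_smult_def sc_mult sum_distrib_left mult.assoc)

lemma gev_var: "gev sc d \<theta> (nc_var x) = hm (d x) (\<theta> x)"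
proof (rule fps_ext)
  fix n
  have "fps_nth (gev sc d \<theta> (nc_var x)) n = (\<Sum>w | wdeg d w = n. if w = [x] then \<theta> x else 0)"
    unfolding gev_nth by (intro sum.cong) (auto simp: nc_var_def sc_zero sc_one)
  then show "fps_nth (gev sc d \<theta> (nc_var x)) n = fps_nth (hm (d x) (\<theta> x)) n"
    by (auto simp: sum.delta finite_words)
qed

text \<open>A word of degree \<open>n\<close> with a cut is the same as a pair of words whose
  degrees add up to \<open>n\<close>. Coefficients move past letters because scalars are
  central.\<close>

lemma gev_mult: "gev sc d \<theta> (f * g) = gev sc d \<theta> f * gev sc d \<theta> g"
proof (rule fps_ext)
  fix n
  let ?W = "\<lambda>n. {w. wdeg d w = n}"
  let ?F = "\<lambda>u v. (sc (nc_coeff f u) * wprod \<theta> u) * (sc (nc_coeff g v) * wprod \<theta> v)"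
  have F: "sc (nc_coeff f u * nc_coeff g v) * wprod \<theta> (u @ v) = ?F u v" for u v
    unfolding sc_mult wprod_simps by (metis sc_central mult.assoc)
  have split: "wdeg d (take i w) \<le> wdeg d w" "wdeg d (drop i w) = wdeg d w - wdeg d (take i w)" for i w
    using wdeg_simps(3)[of d "take i w" "drop i w"] by (simp_all del: wdeg_simps)
  have "fps_nth (gev sc d \<theta> (f * g)) n = (\<Sum>w\<in>?W n. \<Sum>i\<le>length w. ?F (take i w) (drop i w))"
    unfolding gev_nth nc_coeff_mult sc_sum sum_distrib_right
    by (intro sum.cong refl) (metis (no_types) F append_take_drop_id)
  also have "\<dots> = (\<Sum>(w, i)\<in>Sigma (?W n) (\<lambda>w. {..length w}). ?F (take i w) (drop i w))"
    by (simp add: sum.Sigma finite_words)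
  also have "\<dots> = (\<Sum>(m, uv)\<in>Sigma {0..n} (\<lambda>m. ?W m \<times> ?W (n - m)). ?F (fst uv) (snd uv))"
    by (rule sum.reindex_bij_witness[of _ "\<lambda>(m, uv). (fst uv @ snd uv, length (fst uv))"
          "\<lambda>(w, i). (wdeg d (take i w), (take i w, drop i w))"])
       (use split in \<open>auto simp: eq_diff_iff\<close>)
  also have "\<dots> = (\<Sum>m=0..n. \<Sum>uv\<in>?W m \<times> ?W (n - m). ?F (fst uv) (snd uv))"
    by (subst sum.Sigma) (auto simp: finite_words)
  also have "\<dots> = (\<Sum>m=0..n. (\<Sum>u\<in>?W m. sc (nc_coeff f u) * wprod \<theta> u) *
      (\<Sum>v\<in>?W (n - m). sc (nc_coeff g v) * wprod \<theta> v))"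
    by (simp add: sum_product sum.cartesian_product case_prod_beta)
  also have "\<dots> = fps_nth (gev sc d \<theta> f * gev sc d \<theta> g) n"
    by (simp add: fps_mult_nth gev_nth)
  finally show "fps_nth (gev sc d \<theta> (f * g)) n = fps_nth (gev sc d \<theta> f * gev sc d \<theta> g) n" .
qed

lemma gev_power: "gev sc d \<theta> (f ^ n) = gev sc d \<theta> f ^ n"
  by (induction n) (auto simp: gev_1 gev_mult)

end

section \<open>Two-variable series and exponentials in a graded target\<close>

definition ev :: "('k \<Rightarrow> 'r::ring_1) \<Rightarrow> (xy, 'k) ncps \<Rightarrow> 'r \<Rightarrow> 'r \<Rightarrow> 'r fps" where
  "ev sc f a b = gev sc (\<lambda>_. 1) (case_xy a b) f"

definition fexp :: "('k::field_char_0 \<Rightarrow> 'r::ring_1) \<Rightarrow> 'r \<Rightarrow> 'r fps" where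
  "fexp sc a = Abs_fps (\<lambda>n. sc (1 / fact n) * a ^ n)"

lemma ev_nth: "fps_nth (ev sc f a b) n = (\<Sum>w | length w = n. sc (nc_coeff f w) * wprod (case_xy a b) w)"
  by (simp add: ev_def gev_def)

lemma finite_xy_words_eq: "finite {w :: xy list. length w = n}"
  by (rule finite_subset[OF _ finite_xy_words[of n]]) auto

context algebra_map
begin

sublocale xy: graded_algebra_map sc "\<lambda>_ :: xy. 1"
  by standard (auto simp: finite_UNIV_xy intro: finite_subset[OF subset_UNIV])

lemmas ev_nth_0 = xy.gev_nth_0[of "case_xy a b" for a b, folded ev_def]

end

context graded_algebra_map
begin

lemma gev_word_eval:
  assumes "gev sc d \<theta> A = hm 1 \<alpha>" "gev sc d \<theta> B = hm 1 \<beta>"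
  shows "gev sc d \<theta> (word_eval A B v) = hm (length v) (wprod (case_xy \<alpha> \<beta>) v)"
  by (induction v) (auto simp: gev_1 hm_0_1 gev_mult assms hm_mult split: xy.split)

text \<open>As \<open>A\<close> and \<open>B\<close> become homogeneous of degree 1, a word of
  length m contributes in degree m only. Words longer than \<open>n\<close> can therefore be
  dropped, and the two remaining finite sums can be swapped.\<close>

lemma gev_nc_eval:
  assumes "nc_coeff A [] = 0" "nc_coeff B [] = 0"
    and "gev sc d \<theta> A = hm 1 \<alpha>" "gev sc d \<theta> B = hm 1 \<beta>"
  shows "gev sc d \<theta> (nc_eval \<phi> A B) = ev sc \<phi> \<alpha> \<beta>"
proof (rule fps_ext)
  fix n
  let ?W = "{w. wdeg d w = n}" and ?V = "{v :: xy list. length v \<le> n}"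
  have "nc_coeff (nc_eval \<phi> A B) w = (\<Sum>v\<in>?V. nc_coeff \<phi> v * nc_coeff (word_eval A B v) w)"
    if "w \<in> ?W" for w
    unfolding nc_eval_def nc_coeff_Abs
  proof (rule Sum_any_superset_0[OF finite_xy_words])
    fix v assume "v \<notin> ?V"
    then have "length w < length v" using that length_le_wdeg[of w] by simp
    then show "nc_coeff \<phi> v * nc_coeff (word_eval A B v) w = 0"
      using nc_coeff_word_eval_order[OF assms(1,2)] by simp
  qed
  then have "fps_nth (gev sc d \<theta> (nc_eval \<phi> A B)) n =
      (\<Sum>w\<in>?W. \<Sum>v\<in>?V. sc (nc_coeff \<phi> v) * (sc (nc_coeff (word_eval A B v) w) * wprod \<theta> w))"
    by (simp add: gev_nth sc_sum sc_mult sum_distrib_right mult.assoc)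
  also have "\<dots> = (\<Sum>v\<in>?V. sc (nc_coeff \<phi> v) * fps_nth (gev sc d \<theta> (word_eval A B v)) n)"
    by (subst sum.swap) (simp add: sum_distrib_left gev_nth)
  also have "\<dots> = (\<Sum>v\<in>?V. sc (nc_coeff \<phi> v) * (if length v = n then wprod (case_xy \<alpha> \<beta>) v else 0))"
    by (simp add: gev_word_eval[OF assms(3,4)] eq_commute)
  also have "\<dots> = (\<Sum>v | length v = n. sc (nc_coeff \<phi> v) * wprod (case_xy \<alpha> \<beta>) v)"
    by (rule sum.mono_neutral_cong_right) (auto simp: finite_xy_words)
  finally show "fps_nth (gev sc d \<theta> (nc_eval \<phi> A B)) n = fps_nth (ev sc \<phi> \<alpha> \<beta>) n"
    by (simp add: ev_nth)
qed

end

locale graded_algebra_map_0 = graded_algebra_map sc d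
  for sc :: "'k::field_char_0 \<Rightarrow> 'r::ring_1" and d :: "'a \<Rightarrow> nat"
begin

lemma gev_nc_exp:
  assumes "nc_coeff A [] = 0" "gev sc d \<theta> A = hm 1 \<alpha>"
  shows "gev sc d \<theta> (nc_exp A) = fexp sc \<alpha>"
proof (rule fps_ext)
  fix n
  let ?W = "{w. wdeg d w = n}"
  have "nc_coeff (nc_exp A) w = (\<Sum>m\<le>n. 1 / fact m * nc_coeff (A ^ m) w)" if "w \<in> ?W" for w
    unfolding nc_exp_def nc_coeff_Abs
  proof (subst Sum_any_superset_0)
    fix m assume "m \<notin> {..n}"
    then have "length w < m" using that length_le_wdeg[of w] by simp
    then show "nc_coeff (A ^ m) w / fact m = 0"
      using nc_coeff_power_order[OF assms(1)] by simp
  qed auto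
  then have "fps_nth (gev sc d \<theta> (nc_exp A)) n =
      (\<Sum>w\<in>?W. \<Sum>m\<le>n. sc (1 / fact m) * (sc (nc_coeff (A ^ m) w) * wprod \<theta> w))"
    by (simp add: gev_nth sc_sum sum_distrib_right flip: mult.assoc sc_mult)
  also have "\<dots> = (\<Sum>m\<le>n. sc (1 / fact m) * fps_nth (gev sc d \<theta> (A ^ m)) n)"
    by (subst sum.swap) (simp add: sum_distrib_left gev_nth)
  also have "\<dots> = (\<Sum>m\<le>n. if m = n then sc (1 / fact m) * \<alpha> ^ m else 0)"
    by (intro sum.cong) (auto simp: gev_power assms(2) hm_power)
  finally show "fps_nth (gev sc d \<theta> (nc_exp A)) n = fps_nth (fexp sc \<alpha>) n"
    by (simp add: fexp_def)
qed

end

section \<open>Evaluation on the completed enveloping algebra\<close>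

primrec magma_eval :: "('g \<Rightarrow> 'r::ring_1) \<Rightarrow> 'g magma \<Rightarrow> 'r" where
  "magma_eval \<tau> (Gen g) = \<tau> g"
| "magma_eval \<tau> (Br x y) = magma_eval \<tau> x * magma_eval \<tau> y - magma_eval \<tau> y * magma_eval \<tau> x"

lemma magma_degree_pos: "0 < magma_degree x"
  by (induction x) auto

lemma finite_magma_degree: "finite {x :: 'g::finite magma. magma_degree x = n}"
proof (induction n rule: less_induct)
  case (less n)
  let ?S = "\<lambda>m. {x :: 'g magma. magma_degree x = m}"
  have "?S n \<subseteq> range Gen \<union> (\<Union>m\<in>{1..<n}. (\<lambda>(x, y). Br x y) ` (?S m \<times> ?S (n - m)))"
  proof
    fix x assume x: "x \<in> ?S n"
    show "x \<in> range Gen \<union> (\<Union>m\<in>{1..<n}. (\<lambda>(x, y). Br x y) ` (?S m \<times> ?S (n - m)))"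
    proof (cases x)
      case (Br y z)
      have "magma_degree y \<in> {1..<n}" "z \<in> ?S (n - magma_degree y)"
        using x Br magma_degree_pos[of y] magma_degree_pos[of z] by auto
      then show ?thesis using Br by blast
    qed auto
  qed
  moreover have "finite (range Gen \<union> (\<Union>m\<in>{1..<n}. (\<lambda>(x, y). Br x y) ` (?S m \<times> ?S (n - m))))"
    using less.IH by auto
  ultimately show ?case by (rule finite_subset)
qed

lemma nc_coeff_sum: "nc_coeff (sum f A) w = (\<Sum>x\<in>A. nc_coeff (f x) w)"
  by (induction A rule: infinite_finite_induct) (auto simp: nc_coeff_simps)

lemma env_of_lie_add: "env_of_lie (p + q) = env_of_lie p + env_of_lie q"
  by (rule ncps_eqI) (auto simp: env_of_lie_def nc_coeff_simps lookup_add split: list.splits)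

lemma env_of_lie_0: "env_of_lie 0 = 0"
  by (rule ncps_eqI) (auto simp: env_of_lie_def nc_coeff_simps split: list.splits)

lemma env_of_lie_minus: "env_of_lie (- p) = - env_of_lie p"
  using env_of_lie_add[of p "- p"] by (simp add: env_of_lie_0 eq_neg_iff_add_eq_0 add.commute)

lemma env_of_lie_diff: "env_of_lie (p - q) = env_of_lie p - env_of_lie q"
  using env_of_lie_add[of p "- q"] by (simp add: env_of_lie_minus)

lemma env_of_lie_sum: "env_of_lie (sum f A) = (\<Sum>x\<in>A. env_of_lie (f x))"
  by (induction A rule: infinite_finite_induct) (auto simp: env_of_lie_0 env_of_lie_add)

lemma env_of_lie_smult: "env_of_lie (na_smult c p) = nc_smult c (env_of_lie p)"
  by (rule ncps_eqI)
     (auto simp: env_of_lie_def nc_smult_def na_smult_def map.rep_eq when_def split: list.splits)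

lemma env_of_lie_single: "env_of_lie (Poly_Mapping.single x c) = nc_smult c (nc_var x)"
  by (rule ncps_eqI)
     (auto simp: env_of_lie_def nc_smult_def nc_var_def lookup_single when_def split: list.splits)

lemma nc_smult_1 [simp]: "nc_smult 1 f = f"
  by (rule ncps_eqI) (simp add: nc_smult_def)

lemma env_of_lie_expand:
  "env_of_lie p = (\<Sum>x\<in>Poly_Mapping.keys p. nc_smult (Poly_Mapping.lookup p x) (nc_var x))"
proof (rule ncps_eqI)
  fix w
  show "nc_coeff (env_of_lie p) w =
      nc_coeff (\<Sum>x\<in>Poly_Mapping.keys p. nc_smult (Poly_Mapping.lookup p x) (nc_var x)) w"
  proof (cases "\<exists>x. w = [x]")
    case True
    then obtain x where w: "w = [x]" by blast
    have "(\<Sum>y\<in>Poly_Mapping.keys p. nc_coeff (nc_smult (Poly_Mapping.lookup p y) (nc_var y)) w) =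
        (\<Sum>y\<in>Poly_Mapping.keys p. if y = x then Poly_Mapping.lookup p y else 0)"
      by (intro sum.cong) (auto simp: w nc_smult_def nc_var_def)
    also have "\<dots> = Poly_Mapping.lookup p x"
      by (simp add: sum.delta in_keys_iff)
    finally show ?thesis by (simp add: nc_coeff_sum w env_of_lie_def)
  qed (auto simp: nc_coeff_sum env_of_lie_def nc_smult_def nc_var_def split: list.splits)
qed

lemma env_of_lie_bracket:
  "env_of_lie (na_bracket p q) = (\<Sum>x\<in>Poly_Mapping.keys p. \<Sum>y\<in>Poly_Mapping.keys q.
     nc_smult (Poly_Mapping.lookup p x * Poly_Mapping.lookup q y) (nc_var (Br x y)))"
  by (simp add: na_bracket_def env_of_lie_sum env_of_lie_single)

lemma t_eq_var: "t i j = nc_var (Gen (i, j))"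
  by (simp add: t_def t_lie_def env_of_lie_single)

lemma nc_coeff_t_Nil [simp]: "nc_coeff (t i j) [] = 0"
  by (simp add: t_def env_of_lie_def)

text \<open>The relations between the \<open>t i j\<close> for elements of an arbitrary ring, with
  brackets read as commutators.\<close>

definition a4_family :: "(4 \<Rightarrow> 4 \<Rightarrow> 'r::ring_1) \<Rightarrow> bool" where
  "a4_family \<tau> \<longleftrightarrow> (\<forall>i. \<tau> i i = 0) \<and> (\<forall>i j. \<tau> i j = \<tau> j i) \<and>
     (\<forall>i j k. distinct [i, j, k] \<longrightarrow> \<tau> i j * (\<tau> i k + \<tau> j k) = (\<tau> i k + \<tau> j k) * \<tau> i j) \<and>
     (\<forall>i j k l. distinct [i, j, k, l] \<longrightarrow> \<tau> i j * \<tau> k l = \<tau> k l * \<tau> i j)"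

text \<open>An intersection of closed ideals is a closed ideal, so the hull is one itself.\<close>

lemma closed_ideal_env_ideal: "closed_ideal (env_ideal R)"
  unfolding env_ideal_def
proof (rule hull_in)
  fix T :: "('a, 'b) env_series set set" assume T: "Ball T closed_ideal"
  show "closed_ideal (\<Inter> T)"
    unfolding closed_ideal_def
  proof (intro conjI ballI allI impI)
    fix f assume f: "\<forall>n. \<exists>g\<in>\<Inter> T. \<forall>w. word_degree w \<le> n \<longrightarrow> nc_coeff f w = nc_coeff g w"
    show "f \<in> \<Inter> T"
    proof
      fix I assume I: "I \<in> T"
      then have "\<forall>n. \<exists>g\<in>I. \<forall>w. word_degree w \<le> n \<longrightarrow> nc_coeff f w = nc_coeff g w"
        using f by blast
      then show "f \<in> I" using T I unfolding closed_ideal_def by blast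
    qed
  qed (use T in \<open>auto simp: closed_ideal_def\<close>)
qed

lemma env_ideal_generators:
  "env_of_lie ` lie_ideal R \<subseteq> env_ideal R"
  "env_of_lie (na_bracket p q) - (env_of_lie p * env_of_lie q - env_of_lie q * env_of_lie p) \<in> env_ideal R"
  unfolding env_ideal_def by (rule order_trans[OF _ hull_subset], blast, rule hull_inc, blast)

lemma wdeg_magma_degree: "wdeg magma_degree w = word_degree w"
  by (simp add: wdeg_def word_degree_def)

context algebra_map
begin

lemma graded_magma: "graded_algebra_map sc (magma_degree :: 'g::finite magma \<Rightarrow> nat)"
  by standard (auto simp: magma_degree_pos finite_magma_degree)

lemma fps_sc_central: "fps_const (sc c) * F = F * fps_const (sc c)"
  by (rule fps_ext) (simp add: sc_central)

context
  fixes \<tau> :: "'g::finite \<Rightarrow> 'r"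
begin

interpretation env: graded_algebra_map sc "magma_degree :: 'g magma \<Rightarrow> nat"
  by (rule graded_magma)

abbreviation genv :: "('g, 'k) env_series \<Rightarrow> 'r fps" where
  "genv \<equiv> gev sc magma_degree (magma_eval \<tau>)"

lemma genv_sum: "genv (sum f A) = (\<Sum>x\<in>A. genv (f x))"
  by (induction A rule: infinite_finite_induct) (auto simp: env.gev_add env.gev_0)

text \<open>Both sides are bilinear, and on elements of the magma the identity is the definition of
  \<open>magma_eval\<close>.\<close>

lemma genv_bracket:
  "genv (env_of_lie (na_bracket p q)) =
   genv (env_of_lie p) * genv (env_of_lie q) - genv (env_of_lie q) * genv (env_of_lie p)"
proof -
  let ?p = "\<lambda>x. fps_const (sc (Poly_Mapping.lookup p x))" and ?q = "\<lambda>x. fps_const (sc (Poly_Mapping.lookup q x))"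
  let ?h = "\<lambda>x. hm (magma_degree x) (magma_eval \<tau> x)"
  let ?P = "Poly_Mapping.keys p" and ?Q = "Poly_Mapping.keys q"
  have p: "genv (env_of_lie p) = (\<Sum>x\<in>?P. ?p x * ?h x)" and q: "genv (env_of_lie q) = (\<Sum>y\<in>?Q. ?q y * ?h y)"
    by (simp_all add: env_of_lie_expand[of p] env_of_lie_expand[of q] genv_sum env.gev_smult env.gev_var)
  have c: "fps_const (sc (a * b)) = fps_const (sc a) * fps_const (sc b)" for a b
    by (simp add: sc_mult)
  have lc: "F * (fps_const (sc c) * G) = fps_const (sc c) * (F * G)" for c F G
    by (metis fps_sc_central mult.assoc)
  have pq: "(?p x * ?h x) * (?q y * ?h y) = ?p x * ?q y * (?h x * ?h y)" for x y
    unfolding mult.assoc lc[of "?h x"] ..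
  have qp: "(?q y * ?h y) * (?p x * ?h x) = ?p x * ?q y * (?h y * ?h x)" for x y
    unfolding mult.assoc lc[of "?h y"] lc[of "?q y"] ..
  have "genv (env_of_lie (na_bracket p q)) =
      (\<Sum>x\<in>?P. \<Sum>y\<in>?Q. ?p x * ?q y * (?h x * ?h y - ?h y * ?h x))"
    by (simp only: env_of_lie_bracket genv_sum env.gev_smult env.gev_var c magma_eval.simps hm_diff
        hm_mult magma_degree.simps add.commute)
  also have "\<dots> = (\<Sum>x\<in>?P. \<Sum>y\<in>?Q. (?p x * ?h x) * (?q y * ?h y))
      - (\<Sum>x\<in>?P. \<Sum>y\<in>?Q. (?q y * ?h y) * (?p x * ?h x))"
    unfolding pq qp right_diff_distrib sum_subtractf ..
  also have "\<dots> = genv (env_of_lie p) * genv (env_of_lie q) - genv (env_of_lie q) * genv (env_of_lie p)"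
    unfolding p q sum_product by (subst (4) sum.swap) (rule refl)
  finally show ?thesis .
qed

text \<open>The kernel of the evaluation is a closed ideal: its \<open>n\<close>-th coefficient only
  sees words of degree \<open>n\<close>, so approximation in bounded degree is enough. Lie elements
  evaluating to 0 form an ideal, as commutators satisfy the Lie axioms.\<close>

lemma genv_env_ideal:
  assumes R: "\<And>p. p \<in> R \<Longrightarrow> genv (env_of_lie p) = 0" and f: "f \<in> env_ideal R"
  shows "genv f = 0"
proof -
  let ?I = "{p. genv (env_of_lie p) = 0}"
  have "na_ideal ?I"
    unfolding na_ideal_def
    by (auto simp: env_of_lie_0 env.gev_0 env_of_lie_add env.gev_add env_of_lie_smult env.gev_smult genv_bracket)
  moreover have "lie_axioms \<union> R \<subseteq> ?I"
    using R by (auto simp: lie_axioms_def env_of_lie_add env.gev_add genv_bracket algebra_simps)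
  ultimately have "lie_ideal R \<subseteq> ?I"
    unfolding lie_ideal_def by (metis hull_minimal)
  moreover have "closed_ideal {f. genv f = 0}"
    unfolding closed_ideal_def
  proof (intro conjI ballI allI impI)
    fix f assume f: "\<forall>n. \<exists>g\<in>{f. genv f = 0}. \<forall>w. word_degree w \<le> n \<longrightarrow> nc_coeff f w = nc_coeff g w"
    have "fps_nth (genv f) n = 0" for n
    proof -
      obtain g where g: "genv g = 0" "\<And>w. word_degree w \<le> n \<Longrightarrow> nc_coeff f w = nc_coeff g w"
        using f by blast
      have "fps_nth (genv f) n = fps_nth (genv g) n"
        unfolding env.gev_nth by (intro sum.cong refl) (simp add: g(2) wdeg_magma_degree)
      then show ?thesis using g(1) by simp
    qed
    then show "f \<in> {f. genv f = 0}" by (simp add: fps_eq_iff)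
  qed (auto simp: env.gev_0 env.gev_add env.gev_mult)
  ultimately have "env_ideal R \<subseteq> {f. genv f = 0}"
    unfolding env_ideal_def by (intro hull_minimal) (auto simp: env.gev_diff env.gev_mult genv_bracket)
  then show ?thesis using f by blast
qed

end

end

locale a4_rep = algebra_map sc for sc :: "'k::field \<Rightarrow> 'r::ring_1" +
  fixes \<tau> :: "4 \<Rightarrow> 4 \<Rightarrow> 'r"
  assumes a4: "a4_family \<tau>"
begin

sublocale env: graded_algebra_map sc "magma_degree :: (4 \<times> 4) magma \<Rightarrow> nat"
  by (rule graded_magma)

abbreviation a4_eval :: "(4 \<times> 4, 'k) env_series \<Rightarrow> 'r fps" where
  "a4_eval \<equiv> gev sc magma_degree (magma_eval (case_prod \<tau>))"

lemma a4_eval_t: "a4_eval (t i j) = hm 1 (\<tau> i j)"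
  by (simp add: t_eq_var env.gev_var)

lemma a4_eval_t_add: "a4_eval (t i j + t k l) = hm 1 (\<tau> i j + \<tau> k l)"
  by (simp add: a4_eval_t env.gev_add hm_add)

lemma a4_eval_lie: "a4_eval (env_of_lie (t_lie i j)) = hm 1 (\<tau> i j)"
  using a4_eval_t[of i j] by (simp add: t_def)

lemma a4_eval_env_ideal:
  assumes "f \<in> env_ideal a4_relators"
  shows "a4_eval f = 0"
proof (rule genv_env_ideal[OF _ assms])
  fix p :: "(4 \<times> 4, 'k) nonassoc" assume "p \<in> a4_relators"
  moreover have "hm 1 a * hm 1 b = hm 1 b * hm 1 a \<longleftrightarrow> a * b = b * a" for a b :: 'r
    by (auto simp: hm_mult fps_eq_iff)
  ultimately show "a4_eval (env_of_lie p) = 0"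
    using a4 unfolding a4_relators_def a4_family_def
    by (auto simp: env_of_lie_diff env_of_lie_add genv_bracket a4_eval_lie env.gev_diff env.gev_add
        hm_0 simp flip: hm_add)
qed

lemma a4_eval_cong: "x \<doteq> y \<Longrightarrow> a4_eval x = a4_eval y"
  using a4_eval_env_ideal[of "x - y"] by (simp add: Ua4_eq_def env.gev_diff)

lemma a4_eval_nc_eval:
  assumes "nc_coeff A [] = 0" "nc_coeff B [] = 0" "a4_eval A = hm 1 \<alpha>" "a4_eval B = hm 1 \<beta>"
  shows "a4_eval (nc_eval \<phi> A B) = ev sc \<phi> \<alpha> \<beta>"
  using assms by (rule env.gev_nc_eval)

lemma a4_eval_pentagon:
  "a4_eval (nc_eval \<phi> (t 1 2) (t 2 3 + t 2 4) * nc_eval \<phi> (t 1 3 + t 2 3) (t 3 4)) =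
     ev sc \<phi> (\<tau> 1 2) (\<tau> 2 3 + \<tau> 2 4) * ev sc \<phi> (\<tau> 1 3 + \<tau> 2 3) (\<tau> 3 4)"
  "a4_eval (nc_eval \<phi> (t 2 3) (t 3 4) * nc_eval \<phi> (t 1 2 + t 1 3) (t 2 4 + t 3 4) * nc_eval \<phi> (t 1 2) (t 2 3)) =
     ev sc \<phi> (\<tau> 2 3) (\<tau> 3 4) * ev sc \<phi> (\<tau> 1 2 + \<tau> 1 3) (\<tau> 2 4 + \<tau> 3 4) * ev sc \<phi> (\<tau> 1 2) (\<tau> 2 3)"
  by (simp_all add: env.gev_mult a4_eval_nc_eval[OF _ _ a4_eval_t a4_eval_t]
      a4_eval_nc_eval[OF _ _ a4_eval_t a4_eval_t_add] a4_eval_nc_eval[OF _ _ a4_eval_t_add a4_eval_t]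
      a4_eval_nc_eval[OF _ _ a4_eval_t_add a4_eval_t_add] nc_coeff_simps)

lemma pentagon_ev:
  assumes "pentagon \<phi>"
  shows "ev sc \<phi> (\<tau> 1 2) (\<tau> 2 3 + \<tau> 2 4) * ev sc \<phi> (\<tau> 1 3 + \<tau> 2 3) (\<tau> 3 4) =
     ev sc \<phi> (\<tau> 2 3) (\<tau> 3 4) * ev sc \<phi> (\<tau> 1 2 + \<tau> 1 3) (\<tau> 2 4 + \<tau> 3 4) * ev sc \<phi> (\<tau> 1 2) (\<tau> 2 3)"
  using a4_eval_cong[OF assms[unfolded pentagon_def]] unfolding a4_eval_pentagon .

end

lemma a4_family_permute:
  assumes "a4_family \<tau>" "inj \<sigma>"
  shows "a4_family (\<lambda>i j. \<tau> (\<sigma> i) (\<sigma> j))"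
  using assms unfolding a4_family_def by (auto simp: inj_eq)

section \<open>Group-like series satisfying the pentagon equation\<close>

lemma all_4: "(\<forall>i :: 4. P i) \<longleftrightarrow> P 1 \<and> P 2 \<and> P 3 \<and> P 4"
  using UNIV_4 by (metis (mono_tags) UNIV_I empty_iff insert_iff)

definition six_family :: "'r::ring_1 \<Rightarrow> 'r \<Rightarrow> 'r \<Rightarrow> 'r \<Rightarrow> 'r \<Rightarrow> 'r \<Rightarrow> 4 \<Rightarrow> 4 \<Rightarrow> 'r" where
  "six_family x12 x13 x14 x23 x24 x34 i j =
     (if i = j then 0 else if {i, j} = {1, 2} then x12 else if {i, j} = {1, 3} then x13
      else if {i, j} = {1, 4} then x14 else if {i, j} = {2, 3} then x23
      else if {i, j} = {2, 4} then x24 else x34)"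

lemma six_family_simps [simp]:
  "six_family x12 x13 x14 x23 x24 x34 i i = 0"
  "six_family x12 x13 x14 x23 x24 x34 1 2 = x12" "six_family x12 x13 x14 x23 x24 x34 2 1 = x12"
  "six_family x12 x13 x14 x23 x24 x34 1 3 = x13" "six_family x12 x13 x14 x23 x24 x34 3 1 = x13"
  "six_family x12 x13 x14 x23 x24 x34 1 4 = x14" "six_family x12 x13 x14 x23 x24 x34 4 1 = x14"
  "six_family x12 x13 x14 x23 x24 x34 2 3 = x23" "six_family x12 x13 x14 x23 x24 x34 3 2 = x23"
  "six_family x12 x13 x14 x23 x24 x34 2 4 = x24" "six_family x12 x13 x14 x23 x24 x34 4 2 = x24"
  "six_family x12 x13 x14 x23 x24 x34 3 4 = x34" "six_family x12 x13 x14 x23 x24 x34 4 3 = x34"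
  by (simp_all add: six_family_def doubleton_eq_iff)

abbreviation commutes :: "'r::ring_1 \<Rightarrow> 'r \<Rightarrow> bool" where
  "commutes a b \<equiv> a * b = b * a"

text \<open>One condition for each of the three pairs of disjoint index pairs, and three conditions
  for each of the four triples of indices.\<close>

lemma a4_family_six:
  assumes "commutes x12 x34" "commutes x13 x24" "commutes x14 x23"
    and "commutes x12 (x13 + x23)" "commutes x13 (x12 + x23)" "commutes x23 (x12 + x13)"
    and "commutes x12 (x14 + x24)" "commutes x14 (x12 + x24)" "commutes x24 (x12 + x14)"
    and "commutes x13 (x14 + x34)" "commutes x14 (x13 + x34)" "commutes x34 (x13 + x14)"
    and "commutes x23 (x24 + x34)" "commutes x24 (x23 + x34)" "commutes x34 (x23 + x24)"
  shows "a4_family (six_family x12 x13 x14 x23 x24 x34)"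
proof -
  have sw: "commutes a (c + b)" if "commutes a (b + c)" for a b c :: 'a
    using that by (simp add: add.commute)
  note r = assms assms(1-3)[symmetric] assms(4-15)[THEN sw]
  show ?thesis
    unfolding a4_family_def all_4 by (simp, intro conjI r)
qed

section \<open>Coproduct and evaluation at sums of commuting arguments\<close>

text \<open>The recursion for the number of ways in which a word arises as a shuffle of
  \<open>v\<close> and \<open>w\<close>: its first letter comes from \<open>v\<close> or from
  \<open>w\<close>.\<close>

lemma Delta_word_Cons:
  "Delta_word (z # u) (v, w) =
     (case v of [] \<Rightarrow> 0 | y # v' \<Rightarrow> if y = z then Delta_word u (v', w) else 0) +
     (case w of [] \<Rightarrow> 0 | y # w' \<Rightarrow> if y = z then Delta_word u (v, w') else (0 :: 'b::ring_1))"
proof -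
  let ?D = "Delta_word u :: 'b xy_tensor"
  have take_Nil: "take i x = [] \<longleftrightarrow> i = 0" if "i \<le> length x" for i and x :: "xy list"
    using that by (cases x) auto
  have take_single: "take i x = [z] \<longleftrightarrow> i = 1 \<and> x \<noteq> [] \<and> hd x = z" if "i \<le> length x" for i and x :: "xy list"
    using that by (cases x; cases i) (auto simp: take_Nil)
  have one_if: "(if c then 1 else 0) * x = (if c then x else 0)" for c and x :: 'b
    by simp
  have 1: "(\<Sum>i\<le>length v. \<Sum>j\<le>length w. tensor (nc_var z) 1 (take i v, take j w) * ?D (drop i v, drop j w)) =
      (case v of [] \<Rightarrow> 0 | y # v' \<Rightarrow> if y = z then ?D (v', w) else 0)"
  proof -
    have "(\<Sum>i\<le>length v. \<Sum>j\<le>length w. tensor (nc_var z) 1 (take i v, take j w) * ?D (drop i v, drop j w)) =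
       (\<Sum>i\<le>length v. \<Sum>j\<le>length w. if j = 0 then if i = 1 then if v \<noteq> [] \<and> hd v = z then ?D (drop 1 v, w) else 0 else 0 else 0)"
      by (intro sum.cong refl) (auto simp: tensor_def nc_var_def nc_coeff_simps take_Nil take_single)
    also have "\<dots> = (case v of [] \<Rightarrow> 0 | y # v' \<Rightarrow> if y = z then ?D (v', w) else 0)"
      by (auto split: list.splits simp: sum.delta)
    finally show ?thesis .
  qed
  have 2: "(\<Sum>i\<le>length v. \<Sum>j\<le>length w. tensor 1 (nc_var z) (take i v, take j w) * ?D (drop i v, drop j w)) =
      (case w of [] \<Rightarrow> 0 | y # w' \<Rightarrow> if y = z then ?D (v, w') else 0)"
  proof -
    have "(\<Sum>i\<le>length v. \<Sum>j\<le>length w. tensor 1 (nc_var z) (take i v, take j w) * ?D (drop i v, drop j w)) =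
       (\<Sum>i\<le>length v. if i = 0 then \<Sum>j\<le>length w. if j = 1 then if w \<noteq> [] \<and> hd w = z then ?D (v, drop 1 w) else 0 else 0 else 0)"
      by (intro sum.cong refl)
         (auto simp: tensor_def nc_var_def nc_coeff_simps take_Nil take_single one_if
           intro!: sum.cong sum.neutral)
    also have "\<dots> = (case w of [] \<Rightarrow> 0 | y # w' \<Rightarrow> if y = z then ?D (v, w') else 0)"
      by (auto split: list.splits simp: sum.delta)
    finally show ?thesis .
  qed
  show ?thesis
    by (simp add: tensor_mult_def distrib_right sum.distrib 1 2)
qed

definition word_pairs :: "nat \<Rightarrow> (xy list \<times> xy list) set" where
  "word_pairs n = {(v, w). length v + length w = n}"

lemma finite_word_pairs: "finite (word_pairs n)"
  by (rule finite_subset[OF _ finite_cartesian_product[OF finite_xy_words[of n] finite_xy_words[of n]]])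
     (auto simp: word_pairs_def)

lemma commutes_wprod:
  assumes "\<And>x. commutes c (\<theta> x)"
  shows "commutes c (wprod \<theta> w)"
  by (induction w) (simp, metis assms mult.assoc wprod_simps(2))

lemma Delta_eq_sum:
  "Delta \<phi> (v, w) = (\<Sum>u | length u = length v + length w. nc_coeff \<phi> u * Delta_word u (v, w))"
  unfolding Delta_def
  by (rule Sum_any_superset_0[OF finite_xy_words_eq]) (metis (mono_tags) Delta_word_homogeneous mem_Collect_eq mult_zero_right)

context algebra_map
begin

text \<open>Expanding the product, the \<theta>-factors can be collected on the left and the
  \<eta>-factors on the right. Each resulting pair of words occurs once for every shuffle that gives
  \<open>u\<close>.\<close>

lemma wprod_add_Delta:
  assumes comm: "\<And>x y. commutes (\<theta> x) (\<eta> y)"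
  shows "wprod (\<lambda>x. \<theta> x + \<eta> x) u =
    (\<Sum>(v, w)\<in>word_pairs (length u). sc (Delta_word u (v, w)) * (wprod \<theta> v * wprod \<eta> w))"
proof (induction u)
  case Nil
  have "word_pairs 0 = {([], [])}" by (auto simp: word_pairs_def)
  then show ?case by (simp add: tensor_def nc_coeff_simps sc_one)
next
  case (Cons z u)
  let ?D = "\<lambda>v w. sc (Delta_word u (v, w))" and ?n = "length u"
  let ?T = "\<lambda>v w. wprod \<theta> v * wprod \<eta> w"
  have 1: "(\<Sum>(v, w)\<in>word_pairs (Suc ?n).
        (case v of [] \<Rightarrow> 0 | y # v' \<Rightarrow> if y = z then ?D v' w else 0) * ?T v w) =
      \<theta> z * (\<Sum>(v, w)\<in>word_pairs ?n. ?D v w * ?T v w)"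
  proof -
    have "\<theta> z * (\<Sum>(v, w)\<in>word_pairs ?n. ?D v w * ?T v w) =
        (\<Sum>(v, w)\<in>word_pairs ?n. ?D v w * ?T (z # v) w)"
      by (simp add: sum_distrib_left case_prod_beta mult.assoc sc_left_commute[of "\<theta> z"])
    also have "\<dots> = (\<Sum>(v, w)\<in>(\<lambda>(v, w). (z # v, w)) ` word_pairs ?n. ?D (tl v) w * ?T v w)"
      by (subst sum.reindex) (auto intro!: inj_onI sum.cong)
    also have "\<dots> = (\<Sum>(v, w)\<in>word_pairs (Suc ?n).
        (case v of [] \<Rightarrow> 0 | y # v' \<Rightarrow> if y = z then ?D v' w else 0) * ?T v w)"
      by (rule sum.mono_neutral_cong_left[OF finite_word_pairs])
         (fastforce simp: word_pairs_def image_iff split: list.splits if_splits)+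
    finally show ?thesis by simp
  qed
  have 2: "(\<Sum>(v, w)\<in>word_pairs (Suc ?n).
        (case w of [] \<Rightarrow> 0 | y # w' \<Rightarrow> if y = z then ?D v w' else 0) * ?T v w) =
      \<eta> z * (\<Sum>(v, w)\<in>word_pairs ?n. ?D v w * ?T v w)"
  proof -
    have c: "\<eta> z * (wprod \<theta> v * r) = wprod \<theta> v * (\<eta> z * r)" for v r
      by (metis commutes_wprod[of "\<eta> z" \<theta>] comm mult.assoc)
    have "\<eta> z * (\<Sum>(v, w)\<in>word_pairs ?n. ?D v w * ?T v w) =
        (\<Sum>(v, w)\<in>word_pairs ?n. ?D v w * ?T v (z # w))"
      by (simp add: sum_distrib_left case_prod_beta sc_left_commute[of "\<eta> z"] c)
    also have "\<dots> = (\<Sum>(v, w)\<in>(\<lambda>(v, w). (v, z # w)) ` word_pairs ?n. ?D v (tl w) * ?T v w)"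
      by (subst sum.reindex) (auto intro!: inj_onI sum.cong)
    also have "\<dots> = (\<Sum>(v, w)\<in>word_pairs (Suc ?n).
        (case w of [] \<Rightarrow> 0 | y # w' \<Rightarrow> if y = z then ?D v w' else 0) * ?T v w)"
      by (rule sum.mono_neutral_cong_left[OF finite_word_pairs])
         (fastforce simp: word_pairs_def image_iff split: list.splits if_splits)+
    finally show ?thesis by simp
  qed
  have "wprod (\<lambda>x. \<theta> x + \<eta> x) (z # u) =
      (\<Sum>(v, w)\<in>word_pairs (Suc ?n).
        (case v of [] \<Rightarrow> 0 | y # v' \<Rightarrow> if y = z then ?D v' w else 0) * ?T v w +
        (case w of [] \<Rightarrow> 0 | y # w' \<Rightarrow> if y = z then ?D v w' else 0) * ?T v w)"
    unfolding case_prod_beta sum.distrib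
    using 1 2 by (simp add: Cons.IH distrib_right case_prod_beta)
  also have "\<dots> = (\<Sum>(v, w)\<in>word_pairs (Suc ?n). sc (Delta_word (z # u) (v, w)) * ?T v w)"
    by (intro sum.cong refl)
       (auto simp: Delta_word_Cons sc_add sc_zero distrib_right simp del: Delta_word.simps split: list.splits)
  finally show ?case by simp
qed

text \<open>Evaluation at the sums is the coproduct followed by evaluation at (\<open>a\<close>,
  \<open>b\<close>) in one tensor factor and at (\<open>c\<close>, \<open>e\<close>) in the other,
  and \<Delta>(\<phi>) = \<phi> \<otimes> \<phi>.\<close>

lemma ev_group_like_add:
  assumes "group_like \<phi>" "commutes a c" "commutes a e" "commutes b c" "commutes b e"
  shows "ev sc \<phi> (a + c) (b + e) = ev sc \<phi> a b * ev sc \<phi> c e"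
proof (rule fps_ext)
  fix n
  let ?T = "\<lambda>v w. wprod (case_xy a b) v * wprod (case_xy c e) w"
  have sumxy: "case_xy (a + c) (b + e) = (\<lambda>x. case_xy a b x + case_xy c e x)"
    by (rule ext) (auto split: xy.split)
  have comm: "commutes (case_xy a b x) (case_xy c e y)" for x y
    using assms by (auto split: xy.split)
  have D: "(\<Sum>u | length u = n. nc_coeff \<phi> u * Delta_word u (v, w)) = nc_coeff \<phi> v * nc_coeff \<phi> w"
    if "(v, w) \<in> word_pairs n" for v w
    using that assms(1) Delta_eq_sum[of \<phi> v w] by (simp add: word_pairs_def group_like_def tensor_def)
  have "fps_nth (ev sc \<phi> (a + c) (b + e)) n =
      (\<Sum>u | length u = n. \<Sum>(v, w)\<in>word_pairs n. sc (nc_coeff \<phi> u * Delta_word u (v, w)) * ?T v w)"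
    unfolding ev_nth sumxy
    by (intro sum.cong refl)
       (auto simp: wprod_add_Delta[OF comm] sum_distrib_left case_prod_beta sc_mult mult.assoc)
  also have "\<dots> = (\<Sum>(v, w)\<in>word_pairs n. \<Sum>u | length u = n. sc (nc_coeff \<phi> u * Delta_word u (v, w)) * ?T v w)"
    unfolding case_prod_beta by (rule sum.swap)
  also have "\<dots> = (\<Sum>(v, w)\<in>word_pairs n. sc (nc_coeff \<phi> v * nc_coeff \<phi> w) * ?T v w)"
    by (intro sum.cong refl) (auto simp flip: D sc_sum sum_distrib_right)
  also have "\<dots> = (\<Sum>(v, w)\<in>word_pairs n. (sc (nc_coeff \<phi> v) * wprod (case_xy a b) v) *
      (sc (nc_coeff \<phi> w) * wprod (case_xy c e) w))"
    by (intro sum.cong refl) (auto simp: sc_mult mult.assoc sc_left_commute[of "wprod _ _"])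
  also have "\<dots> = (\<Sum>(m, v, w)\<in>Sigma {0..n} (\<lambda>m. {v. length v = m} \<times> {w. length w = n - m}).
      (sc (nc_coeff \<phi> v) * wprod (case_xy a b) v) * (sc (nc_coeff \<phi> w) * wprod (case_xy c e) w))"
    by (rule sum.reindex_bij_witness[of _ "\<lambda>(m, v, w). (v, w)" "\<lambda>(v, w). (length v, v, w)"])
       (auto simp: word_pairs_def)
  also have "\<dots> = (\<Sum>m=0..n. \<Sum>(v, w)\<in>{v. length v = m} \<times> {w. length w = n - m}.
      (sc (nc_coeff \<phi> v) * wprod (case_xy a b) v) * (sc (nc_coeff \<phi> w) * wprod (case_xy c e) w))"
    by (subst sum.Sigma) (auto simp: finite_xy_words_eq)
  also have "\<dots> = fps_nth (ev sc \<phi> a b * ev sc \<phi> c e) n"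
    by (simp add: fps_mult_nth ev_nth sum_product sum.cartesian_product)
  finally show "fps_nth (ev sc \<phi> (a + c) (b + e)) n = fps_nth (ev sc \<phi> a b * ev sc \<phi> c e) n" .
qed

lemma ev_nth_constant_word:
  assumes "\<theta> = case_xy a b" "\<And>y. y \<noteq> x \<Longrightarrow> \<theta> y = 0"
  shows "fps_nth (ev sc f a b) n = sc (nc_coeff f (replicate n x)) * \<theta> x ^ n"
proof -
  have w: "wprod \<theta> w = (if w = replicate (length w) x then \<theta> x ^ length w else 0)" for w
    by (induction w) (auto simp: assms(2))
  have "fps_nth (ev sc f a b) n =
      (\<Sum>w | length w = n. if w = replicate n x then sc (nc_coeff f w) * \<theta> x ^ n else 0)"
    unfolding ev_nth assms(1)[symmetric] by (intro sum.cong refl) (subst w, auto)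
  then show ?thesis by (simp add: sum.delta finite_xy_words_eq)
qed

lemmas ev_X_0_nth = ev_nth_constant_word[OF refl, of LX a 0 for a, simplified xy.case]
lemmas ev_0_Y_nth = ev_nth_constant_word[OF refl, of LY 0 b for b, simplified xy.case]

end

lemma algebra_map_id: "algebra_map (\<lambda>x :: 'k::field. x)"
  by standard (auto simp: mult.commute)

section \<open>First consequences of the pentagon equation\<close>

lemma power_coeffs_eq_0:
  fixes \<phi> :: "(xy, 'k::field) ncps"
  assumes "group_like \<phi>" "pentagon \<phi>" "n > 0"
  shows "nc_coeff \<phi> (replicate n LX) = 0" "nc_coeff \<phi> (replicate n LY) = 0"
proof -
  interpret algebra_map "\<lambda>x :: 'k. x" by (rule algebra_map_id)
  let ?e = "ev (\<lambda>x. x) \<phi>"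
  have X: "fps_nth (?e a 0) m = nc_coeff \<phi> (replicate m LX) * a ^ m" for a m
    by (rule ev_X_0_nth) (metis xy.exhaust xy.case)
  have Y: "fps_nth (?e 0 a) m = nc_coeff \<phi> (replicate m LY) * a ^ m" for a m
    by (rule ev_0_Y_nth) (metis xy.exhaust xy.case)
  have Nil: "nc_coeff \<phi> [] = 1" using assms(1) by (simp add: group_like_def)
  have e0: "?e 0 0 = 1"
    by (rule fps_ext) (use X[of 0] Nil in \<open>auto simp: power_0_left\<close>)
  \<comment> \<open>With \<open>t 1 2\<close> = 1 the pentagon equation reads \<phi>(1, 0) =
    \<phi>(1, 0)^2, with \<open>t 3 4\<close> = 1 it reads \<phi>(0, 1) = \<phi>(0, 1)^2;
    cancellation is possible as \<open>'k fps\<close> is an integral domain.\<close>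
  have idem: "F = 1" if "F = F * F" "fps_nth F 0 = 1" for F :: "'k fps"
    using that by (metis mult_cancel_left1 fps_zero_nth zero_neq_one)
  interpret A: a4_rep "\<lambda>x :: 'k. x" "six_family 1 0 0 0 0 0"
    by standard (auto intro: a4_family_six)
  have "?e 1 0 = 1"
    using A.pentagon_ev[OF assms(2)] X[of 1 0] Nil by (intro idem) (auto simp: e0)
  then show "nc_coeff \<phi> (replicate n LX) = 0"
    using X[of 1 n] assms(3) by simp
  interpret B: a4_rep "\<lambda>x :: 'k. x" "six_family 0 0 0 0 0 1"
    by standard (auto intro: a4_family_six)
  have "?e 0 1 = 1"
    using B.pentagon_ev[OF assms(2)] Y[of 1 0] Nil by (intro idem) (auto simp: e0)
  then show "nc_coeff \<phi> (replicate n LY) = 0"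
    using Y[of 1 n] assms(3) by simp
qed

locale pentagon_rep = algebra_map sc for sc :: "'k::field \<Rightarrow> 'r::ring_1" +
  fixes \<phi> :: "(xy, 'k) ncps"
  assumes group_like: "group_like \<phi>" and pentagon: "pentagon \<phi>"
begin

abbreviation p :: "'r \<Rightarrow> 'r \<Rightarrow> 'r fps" where
  "p \<equiv> ev sc \<phi>"

lemma phi_Nil: "nc_coeff \<phi> [] = 1"
  using group_like by (simp add: group_like_def)

lemma p_X_0: "p a 0 = 1"
proof (rule fps_ext)
  fix n
  have "fps_nth (p a 0) n = sc (nc_coeff \<phi> (replicate n LX)) * a ^ n"
    by (rule ev_X_0_nth) (metis xy.exhaust xy.case)
  then show "fps_nth (p a 0) n = fps_nth 1 n"
    using power_coeffs_eq_0(1)[OF group_like pentagon, of n] phi_Nil by (auto simp: sc_zero sc_one)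
qed

lemma p_0_Y: "p 0 a = 1"
proof (rule fps_ext)
  fix n
  have "fps_nth (p 0 a) n = sc (nc_coeff \<phi> (replicate n LY)) * a ^ n"
    by (rule ev_0_Y_nth) (metis xy.exhaust xy.case)
  then show "fps_nth (p 0 a) n = fps_nth 1 n"
    using power_coeffs_eq_0(2)[OF group_like pentagon, of n] phi_Nil by (auto simp: sc_zero sc_one)
qed

text \<open>Split (\<open>a\<close>, \<open>b\<close>) as (\<open>a\<close>, 0) + (0,
  \<open>b\<close>). The two shift rules below split off (\<open>c\<close>, 0) and (0,
  \<open>c\<close>) in the same way.\<close>

lemma p_commuting: "commutes a b \<Longrightarrow> p a b = 1"
  using ev_group_like_add[OF group_like, of a 0 b 0]
  by (simp add: p_X_0 p_0_Y)

lemma p_shift_left: "commutes c a \<Longrightarrow> commutes c b \<Longrightarrow> p (a + c) b = p a b"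
  using ev_group_like_add[OF group_like, of a c 0 b] by (simp add: p_X_0)

lemma p_shift_right: "commutes c a \<Longrightarrow> commutes c b \<Longrightarrow> p a (b + c) = p a b"
  using ev_group_like_add[OF group_like, of a 0 c b] by (simp add: p_0_Y)

lemma p_swap: "p b a * p a b = 1"
proof -
  \<comment> \<open>Complementary index pairs get the same value, and the three values
    \<open>a\<close>, \<open>b\<close>, \<open>- a - b\<close> add up to 0. Three factors of the
    pentagon equation then have commuting arguments: (\<open>a\<close>, \<open>- a\<close>),
    (\<open>- a\<close>, \<open>a\<close>) and (\<open>- b\<close>, \<open>- b\<close>).\<close>
  interpret A: a4_rep sc "six_family a (- a - b) b b (- a - b) a"
    by standard (rule a4_family_six; simp add: algebra_simps)
  show ?thesis
    using A.pentagon_ev[OF pentagon] by (simp add: p_commuting algebra_simps)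
qed

lemma p_nth_0 [simp]: "fps_nth (p a b) 0 = 1"
  by (simp add: ev_nth_0 phi_Nil sc_one)

end

section \<open>The hexagon defect is a cocycle\<close>

lemma commutes_add_right: "commutes a b \<Longrightarrow> commutes a c \<Longrightarrow> commutes a (b + c)"
  by (simp add: distrib_left distrib_right)

lemma commutes_add_left: "commutes a c \<Longrightarrow> commutes b c \<Longrightarrow> commutes (a + b) c"
  by (simp add: distrib_left distrib_right)

lemma commutes_diff_right: "commutes a b \<Longrightarrow> commutes a c \<Longrightarrow> commutes a (b - c)"
  by (simp add: right_diff_distrib left_diff_distrib)

lemma commutes_mult_left: "commutes a c \<Longrightarrow> commutes b c \<Longrightarrow> commutes (a * b) c"
  by (metis mult.assoc)

lemma commutes_power_left: "commutes a c \<Longrightarrow> commutes (a ^ n) c"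
  by (induction n) (auto intro: commutes_mult_left)

lemma commutes_fps:
  fixes F G :: "'r::ring_1 fps"
  assumes "\<And>i j. commutes (fps_nth F i) (fps_nth G j)"
  shows "commutes F G"
proof (rule fps_ext)
  fix n
  have "fps_nth (F * G) n = (\<Sum>i=0..n. fps_nth G (n - i) * fps_nth F i)"
    by (simp add: fps_mult_nth assms)
  also have "\<dots> = (\<Sum>i=0..n. fps_nth G i * fps_nth F (n - i))"
    by (rule sum.reindex_bij_witness[of _ "\<lambda>i. n - i" "\<lambda>i. n - i"]) auto
  finally show "fps_nth (F * G) n = fps_nth (G * F) n"
    by (simp add: fps_mult_nth)
qed

lemma fps_mult_nth_low_right:
  fixes F G :: "'r::ring_1 fps"
  assumes "\<And>i. i < n \<Longrightarrow> fps_nth G i = 0" "m \<le> n"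
  shows "fps_nth (F * G) m = fps_nth F 0 * fps_nth G m"
proof -
  have "fps_nth (F * G) m = (\<Sum>i=0..m. if i = 0 then fps_nth F 0 * fps_nth G m else 0)"
    unfolding fps_mult_nth using assms by (intro sum.cong) auto
  then show ?thesis by simp
qed

lemma fps_mult_nth_low_left:
  fixes F G :: "'r::ring_1 fps"
  assumes "\<And>i. i < n \<Longrightarrow> fps_nth F i = 0" "m \<le> n"
  shows "fps_nth (F * G) m = fps_nth F m * fps_nth G 0"
proof -
  have "fps_nth (F * G) m = (\<Sum>i=0..m. if i = m then fps_nth F m * fps_nth G 0 else 0)"
    unfolding fps_mult_nth using assms by (intro sum.cong) auto
  then show ?thesis by simp
qed

lemma a4_familyD:
  assumes "a4_family \<tau>"
  shows "\<tau> i j = \<tau> j i"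
    and "distinct [i, j, k] \<Longrightarrow> commutes (\<tau> i j) (\<tau> i k + \<tau> j k)"
    and "distinct [i, j, k, l] \<Longrightarrow> commutes (\<tau> i j) (\<tau> k l)"
  using assms unfolding a4_family_def by blast+

context pentagon_rep
begin

text \<open>The relations are symmetric in the indices, so the pentagon equation may be used after
  any permutation of 1, 2, 3, 4.\<close>

lemma pentagon_indices:
  assumes "a4_family \<tau>" "distinct [a, b, c, e]"
  shows "p (\<tau> a b) (\<tau> b c + \<tau> b e) * p (\<tau> a c + \<tau> b c) (\<tau> c e) =
     p (\<tau> b c) (\<tau> c e) * p (\<tau> a b + \<tau> a c) (\<tau> b e + \<tau> c e) * p (\<tau> a b) (\<tau> b c)"
proof -
  define \<sigma> where "\<sigma> i = (if i = 1 then a else if i = 2 then b else if i = 3 then c else e)" for i :: 4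
  have "inj \<sigma>"
    unfolding inj_def all_4 using assms(2) by (auto simp: \<sigma>_def)
  then interpret A: a4_rep sc "\<lambda>i j. \<tau> (\<sigma> i) (\<sigma> j)"
    using assms(1) by unfold_locales (rule a4_family_permute)
  show ?thesis
    using A.pentagon_ev[OF pentagon] by (simp add: \<sigma>_def)
qed

end

locale hexagon_rep = pentagon_rep sc \<phi>
  for sc :: "'k::field_char_0 \<Rightarrow> 'r::ring_1" and \<phi> :: "(xy, 'k) ncps" +
  fixes \<mu> :: 'k
begin

text \<open>The exponential of \<mu>\<open>a\<close>T/2, where T records the degree.\<close>

definition E :: "'r \<Rightarrow> 'r fps" where
  "E a = fexp sc (sc (\<mu> / 2) * a)"

lemma E_nth: "fps_nth (E a) n = sc ((\<mu> / 2) ^ n / fact n) * a ^ n"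
proof -
  have "(sc c * a) ^ n = sc (c ^ n) * a ^ n" for c
    by (induction n) (auto simp: sc_one sc_mult mult.assoc sc_left_commute[of "a"] sc_left_commute[of "a ^ _"])
  then show ?thesis
    unfolding E_def fexp_def by (simp flip: mult.assoc sc_mult)
qed

lemma E_nth_0 [simp]: "fps_nth (E a) 0 = 1"
  by (simp add: E_nth sc_one)

lemma commutes_E_p:
  assumes "commutes c a" "commutes c b"
  shows "commutes (E c) (p a b)"
proof (rule commutes_fps)
  fix i j
  have "commutes c (wprod (case_xy a b) w)" for w
    by (rule commutes_wprod) (auto simp: assms split: xy.split)
  then have "commutes (c ^ i) (fps_nth (p a b) j)"
    unfolding ev_nth by (intro commutes_power_left)
      (simp add: sum_distrib_left sum_distrib_right mult.assoc sc_left_commute[of c])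
  then show "commutes (fps_nth (E c) i) (fps_nth (p a b) j)"
    unfolding E_nth by (intro commutes_mult_left sc_central)
qed

text \<open>The right-hand side of the first hexagon equation for \<open>a = t\<^sub>1\<^sub>3\<close>, \<open>b = t\<^sub>2\<^sub>3\<close> and of the second one
  for \<open>a = t\<^sub>1\<^sub>3\<close>, \<open>b = t\<^sub>1\<^sub>2\<close>: the third generator is \<open>- a - b\<close> up to a central element, and
  \<open>\<phi>(a, b)\<^sup>-\<^sup>1 = \<phi>(b, a)\<close>.\<close>

definition hex :: "'r \<Rightarrow> 'r \<Rightarrow> 'r fps" where
  "hex a b = p a (- a - b) * E a * p b a * E b * p (- a - b) b"

lemma hex_eq:
  assumes "commutes c a" "commutes c b" "c = a + b + e"
  shows "hex a b = p a e * E a * p b a * E b * p e b"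
proof -
  have e: "- a - b + c = e" using assms(3) by simp
  have "p a e = p a (- a - b)" "p e b = p (- a - b) b"
    using p_shift_right[of c a "- a - b"] p_shift_left[of c "- a - b" b] assms(1,2)
    unfolding e by (simp_all add: commutes_diff_right)
  then show ?thesis by (simp add: hex_def)
qed

text \<open>The two inner products express the passage of strand 4 across strands 1, 2 and across strands
  2, 3. The outer factors complete them to its passage across 1, 2, 3, with these bracketed as
  \<open>(12)3\<close> on the left and as \<open>1(23)\<close> on the right.\<close>

lemma move_strand:
  assumes a4: "a4_family \<tau>"
  shows "p (\<tau> 1 2) (\<tau> 2 3) * (p (\<tau> 1 4 + \<tau> 2 4) (\<tau> 1 3 + \<tau> 2 3) *
      (p (\<tau> 1 4) (\<tau> 1 2) * E (\<tau> 1 4) * p (\<tau> 2 4) (\<tau> 1 4) * E (\<tau> 2 4) * p (\<tau> 1 2) (\<tau> 2 4)) *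
      p (\<tau> 3 4) (\<tau> 1 4 + \<tau> 2 4) * E (\<tau> 3 4) * p (\<tau> 1 3 + \<tau> 2 3) (\<tau> 3 4)) =
    p (\<tau> 1 4) (\<tau> 1 2 + \<tau> 1 3) * E (\<tau> 1 4) * p (\<tau> 2 4 + \<tau> 3 4) (\<tau> 1 4) *
      (p (\<tau> 2 4) (\<tau> 2 3) * E (\<tau> 2 4) * p (\<tau> 3 4) (\<tau> 2 4) * E (\<tau> 3 4) * p (\<tau> 2 3) (\<tau> 3 4)) *
      p (\<tau> 1 2 + \<tau> 1 3) (\<tau> 2 4 + \<tau> 3 4) * p (\<tau> 1 2) (\<tau> 2 3)"
proof -
  note sym = a4_familyD(1)[OF a4]
  have sy: "\<tau> 2 1 = \<tau> 1 2" "\<tau> 3 1 = \<tau> 1 3" "\<tau> 4 1 = \<tau> 1 4" "\<tau> 3 2 = \<tau> 2 3" "\<tau> 4 2 = \<tau> 2 4" "\<tau> 4 3 = \<tau> 3 4"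
    by (rule sym)+
  define Q a1 a2 a2' a3 where Q: "Q = p (\<tau> 1 2) (\<tau> 2 3)" and a1: "a1 = p (\<tau> 1 4) (\<tau> 1 2 + \<tau> 1 3)"
    and a2: "a2 = p (\<tau> 2 4 + \<tau> 3 4) (\<tau> 1 4)" and a2': "a2' = p (\<tau> 1 4) (\<tau> 2 4 + \<tau> 3 4)"
    and a3: "a3 = p (\<tau> 1 2 + \<tau> 1 3) (\<tau> 2 4 + \<tau> 3 4)"
  define b1 b2 b2' b3 where b1: "b1 = p (\<tau> 2 4) (\<tau> 2 3)" and b2: "b2 = p (\<tau> 3 4) (\<tau> 2 4)"
    and b2': "b2' = p (\<tau> 2 4) (\<tau> 3 4)" and b3: "b3 = p (\<tau> 2 3) (\<tau> 3 4)"
  define c1 c2 d1 d1' d2 d3 where c1: "c1 = p (\<tau> 1 2) (\<tau> 2 3 + \<tau> 2 4)" and c2: "c2 = p (\<tau> 1 3 + \<tau> 2 3) (\<tau> 3 4)"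
    and d1: "d1 = p (\<tau> 1 4 + \<tau> 2 4) (\<tau> 3 4)" and d1': "d1' = p (\<tau> 3 4) (\<tau> 1 4 + \<tau> 2 4)"
    and d2: "d2 = p (\<tau> 1 2 + \<tau> 1 4) (\<tau> 2 3 + \<tau> 3 4)" and d3: "d3 = p (\<tau> 1 2) (\<tau> 2 4)"
  define e1 e2 e2' f1 f2 where e1: "e1 = p (\<tau> 1 2 + \<tau> 2 4) (\<tau> 2 3)" and e2: "e2 = p (\<tau> 1 4) (\<tau> 2 4)"
    and e2': "e2' = p (\<tau> 2 4) (\<tau> 1 4)" and f1: "f1 = p (\<tau> 1 4 + \<tau> 2 4) (\<tau> 1 3 + \<tau> 2 3)"
    and f2: "f2 = p (\<tau> 1 4) (\<tau> 1 2)"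
  define E1 E2 E3 where E1: "E1 = E (\<tau> 1 4)" and E2: "E2 = E (\<tau> 2 4)" and E3: "E3 = E (\<tau> 3 4)"
  \<comment> \<open>The four pentagons belong to the orders 1234, 1243, 1423 and 4123, in which
    strand 4 travels from the last place to the first.\<close>
  have P1: "c1 * c2 = b3 * a3 * Q"
    using pentagon_indices[OF a4, of 1 2 3 4] by (simp add: sy c1 c2 b3 a3 Q)
  have P2: "c1 * d1 = b2' * d2 * d3"
    using pentagon_indices[OF a4, of 1 2 4 3] by (simp add: sy c1 d1 b2' d2 d3 add.commute)
  have P3: "a2' * e1 = b1 * d2 * e2"
    using pentagon_indices[OF a4, of 1 4 2 3] by (simp add: sy a2' e1 b1 d2 e2 add.commute)
  have P4: "a1 * e1 = Q * f1 * f2"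
    using pentagon_indices[OF a4, of 4 1 2 3] by (simp add: sy a1 e1 Q f1 f2 add.commute)
  \<comment> \<open>Each exponential commutes with the one factor it has to pass, by the relations
    for the index triples and disjoint pairs involved.\<close>
  have k3: "E3 * c1 = c1 * E3"
    unfolding E3 c1 using a4_familyD(3)[OF a4, of 3 4 1 2] a4_familyD(2)[OF a4, of 3 4 2]
    by (intro commutes_E_p) (simp_all add: sy)
  have k2: "E2 * d2 = d2 * E2"
    unfolding E2 d2 using a4_familyD(2)[OF a4, of 2 4 1] a4_familyD(2)[OF a4, of 2 4 3]
    by (intro commutes_E_p) (simp_all add: sy)
  have k1: "E1 * e1 = e1 * E1"
    unfolding E1 e1 using a4_familyD(2)[OF a4, of 1 4 2] a4_familyD(3)[OF a4, of 1 4 2 3]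
    by (intro commutes_E_p) (simp_all add: sy)
  have i: "d1 * d1' = 1" "b2 * b2' = 1" "a2 * a2' = 1" "e2 * e2' = 1"
    unfolding d1 d1' b2 b2' a2 a2' e2 e2' by (rule p_swap)+
  have b2c1: "b2 * c1 = d2 * d3 * d1'"
    by (metis P2 i(1,2) mult.assoc mult_1_left mult_1_right)
  have a2b1: "a2 * b1 * d2 = e1 * e2'"
    by (metis P3 i(3,4) mult.assoc mult_1_left mult_1_right)
  \<comment> \<open>Start from the right-hand side. Each pentagon replaces the factors next to an
    exponential by factors that this exponential can pass.\<close>
  have "a1 * E1 * a2 * (b1 * E2 * b2 * E3 * b3) * a3 * Q = a1 * E1 * a2 * b1 * E2 * b2 * E3 * (b3 * a3 * Q)"
    by (simp add: mult.assoc)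
  also have "\<dots> = a1 * E1 * a2 * b1 * E2 * b2 * (E3 * c1) * c2"
    unfolding P1[symmetric] by (simp add: mult.assoc)
  also have "\<dots> = a1 * E1 * a2 * b1 * E2 * (b2 * c1) * E3 * c2"
    unfolding k3 by (simp add: mult.assoc)
  also have "\<dots> = a1 * E1 * a2 * b1 * (E2 * d2) * d3 * d1' * E3 * c2"
    unfolding b2c1 by (simp add: mult.assoc)
  also have "\<dots> = a1 * E1 * (a2 * b1 * d2) * E2 * d3 * d1' * E3 * c2"
    unfolding k2 by (simp add: mult.assoc)
  also have "\<dots> = a1 * (E1 * e1) * e2' * E2 * d3 * d1' * E3 * c2"
    unfolding a2b1 by (simp add: mult.assoc)
  also have "\<dots> = (a1 * e1) * E1 * e2' * E2 * d3 * d1' * E3 * c2"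
    unfolding k1 by (simp add: mult.assoc)
  also have "\<dots> = Q * (f1 * (f2 * E1 * e2' * E2 * d3) * d1' * E3 * c2)"
    unfolding P4 by (simp add: mult.assoc)
  finally show ?thesis
    unfolding Q a1 a2 a3 b1 b2 b3 c2 d1' d3 e2' f1 f2 E1 E2 E3 by (rule HOL.sym)
qed

definition defect :: "'r \<Rightarrow> 'r \<Rightarrow> 'r fps" where
  "defect a b = hex a b - E (a + b)"

text \<open>Insert \<open>hex\<close> = \<open>E\<close> + \<open>defect\<close> into
  \<open>move_strand\<close>. The exponentials combine to the same \<open>S\<close> on both sides
  and cancel; in lowest degree the defects are not changed by outer factors with constant term
  1.\<close>

lemma defect_cocycle:
  assumes a4: "a4_family \<tau>" and low: "\<And>a b i. i < n \<Longrightarrow> fps_nth (defect a b) i = 0"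
  defines "x \<equiv> \<tau> 1 4" and "y \<equiv> \<tau> 2 4" and "z \<equiv> \<tau> 3 4"
  shows "fps_nth (defect (x + y) z) n + fps_nth (defect x y) n =
    fps_nth (defect x (y + z)) n + fps_nth (defect y z) n"
proof -
  have sy: "\<tau> 2 1 = \<tau> 1 2" "\<tau> 3 1 = \<tau> 1 3" "\<tau> 4 1 = \<tau> 1 4" "\<tau> 3 2 = \<tau> 2 3" "\<tau> 4 2 = \<tau> 2 4" "\<tau> 4 3 = \<tau> 3 4"
    by (rule a4_familyD(1)[OF a4])+
  note com = a4_familyD(2)[OF a4] a4_familyD(3)[OF a4]
  have t1: "commutes x (\<tau> 1 2 + y)" "commutes x (\<tau> 1 3 + z)" "commutes x (\<tau> 2 3)"
    using com(1)[of 1 4 2] com(1)[of 1 4 3] com(2)[of 1 4 2 3] by (simp_all add: sy x_def y_def z_def)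
  have t2: "commutes y (\<tau> 1 2 + x)" "commutes y (\<tau> 2 3 + z)" "commutes y (\<tau> 1 3)"
    using com(1)[of 2 4 1] com(1)[of 2 4 3] com(2)[of 2 4 1 3] by (simp_all add: sy x_def y_def z_def)
  have t3: "commutes z (\<tau> 1 3 + x)" "commutes z (\<tau> 2 3 + y)" "commutes z (\<tau> 1 2)"
    using com(1)[of 3 4 1] com(1)[of 3 4 2] com(2)[of 3 4 1 2] by (simp_all add: sy x_def y_def z_def)
  have t4: "commutes (\<tau> 1 2) (x + y)" "commutes (\<tau> 2 3) (y + z)"
    using com(1)[of 1 2 4] com(1)[of 2 3 4] by (simp_all add: sy x_def y_def z_def)
  \<comment> \<open>For \<open>hex_eq\<close> the sum of the three elements involved has to commute
    with both arguments. When strands are merged, some of the three elements are themselves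
    sums.\<close>
  have Hxy: "hex x y = p x (\<tau> 1 2) * E x * p y x * E y * p (\<tau> 1 2) y"
    by (rule hex_eq[of "x + y + \<tau> 1 2"]) (use t1 t2 in \<open>simp_all add: algebra_simps\<close>)
  have Hyz: "hex y z = p y (\<tau> 2 3) * E y * p z y * E z * p (\<tau> 2 3) z"
    by (rule hex_eq[of "y + z + \<tau> 2 3"]) (use t2 t3 in \<open>simp_all add: algebra_simps\<close>)
  have k: "commutes (a + b) a" if "commutes a b" for a b :: 'r
    using that by (simp add: distrib_left distrib_right)
  have m1: "commutes x (z + (\<tau> 1 3 + \<tau> 2 3))" and m2: "commutes y (z + (\<tau> 1 3 + \<tau> 2 3))"
    and m3: "commutes z (x + y + (\<tau> 1 3 + \<tau> 2 3))"
    using commutes_add_right[OF t1(2,3)] commutes_add_right[OF t2(2,3)] commutes_add_right[OF t3(1,2)]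
    by (simp_all only: add_ac)
  have n1: "commutes x (y + z + (\<tau> 1 2 + \<tau> 1 3))" and n2: "commutes y (x + (\<tau> 1 2 + \<tau> 1 3))"
    and n3: "commutes z (x + (\<tau> 1 2 + \<tau> 1 3))"
    using commutes_add_right[OF t1(1,2)] commutes_add_right[OF t2(1,3)] commutes_add_right[OF t3(1,3)]
    by (simp_all only: add_ac)
  have Hxyz: "hex (x + y) z =
      p (x + y) (\<tau> 1 3 + \<tau> 2 3) * E (x + y) * p z (x + y) * E z * p (\<tau> 1 3 + \<tau> 2 3) z"
    by (rule hex_eq[of "x + y + z + (\<tau> 1 3 + \<tau> 2 3)"])
       (use k[OF commutes_add_left[OF m1 m2]] k[OF m3] in \<open>simp_all only: add_ac\<close>)
  have Hxyz': "hex x (y + z) =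
      p x (\<tau> 1 2 + \<tau> 1 3) * E x * p (y + z) x * E (y + z) * p (\<tau> 1 2 + \<tau> 1 3) (y + z)"
    by (rule hex_eq[of "x + (y + z) + (\<tau> 1 2 + \<tau> 1 3)"])
       (use k[OF n1] k[OF commutes_add_left[OF n2 n3]] in \<open>simp_all only: add_ac\<close>)
  define Q where "Q = p (\<tau> 1 2) (\<tau> 2 3)"
  define S where "S = E (x + y + z)"
  \<comment> \<open>This allows \<open>S\<close> to pass \<open>Q\<close> and to drop out of the
    comparison of the two sides.\<close>
  have "commutes (x + y + z) (\<tau> 1 2)" "commutes (x + y + z) (\<tau> 2 3)"
    using t4 t1(3) t3(3) by (simp_all add: algebra_simps)
  then have QS: "Q * S = S * Q"
    unfolding Q_def S_def by (metis commutes_E_p)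
  define F G where "F = p (x + y) (\<tau> 1 3 + \<tau> 2 3)" and "G = p z (x + y) * E z * p (\<tau> 1 3 + \<tau> 2 3) z"
  define F' G' where "F' = p x (\<tau> 1 2 + \<tau> 1 3) * E x * p (y + z) x" and "G' = p (\<tau> 1 2 + \<tau> 1 3) (y + z)"
  define \<alpha> \<beta> where "\<alpha> = defect (x + y) z + F * defect x y * G" and "\<beta> = defect x (y + z) + F' * defect y z * G'"
  \<comment> \<open>The product of \<open>F\<close>, \<open>E (x + y)\<close> and \<open>G\<close>
    is \<open>hex (x + y) z\<close>, hence \<open>S\<close> plus a defect. The identity
    \<open>B\<close> arises likewise from \<open>hex x (y + z)\<close>.\<close>
  have A: "F * hex x y * G = S + \<alpha>"
    using Hxyz unfolding \<alpha>_def defect_def F_def G_def S_def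
    by (simp add: algebra_simps)
  have B: "F' * hex y z * G' = S + \<beta>"
    using Hxyz' unfolding \<beta>_def defect_def F'_def G'_def S_def
    by (simp add: algebra_simps)
  have "Q * (F * hex x y * G) = F' * hex y z * G' * Q"
    using move_strand[OF a4, folded x_def y_def z_def, folded Hxy Hyz]
    unfolding F_def G_def F'_def G'_def Q_def by (simp add: mult.assoc)
  then have QQ: "Q * \<alpha> = \<beta> * Q"
    unfolding A B using QS by (simp add: distrib_left distrib_right)
  have FG0: "fps_nth F 0 = 1" "fps_nth G 0 = 1" "fps_nth F' 0 = 1" "fps_nth G' 0 = 1" "fps_nth Q 0 = 1"
    by (simp_all add: F_def G_def F'_def G'_def Q_def)
  have sandwich: "fps_nth (U * D * V) i = fps_nth D i"
    if "\<And>i. i < n \<Longrightarrow> fps_nth D i = 0" "fps_nth U 0 = 1" "fps_nth V 0 = 1" "i \<le> n" for U D V :: "'r fps" and i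
  proof -
    have UD: "fps_nth (U * D) j = fps_nth D j" if "j \<le> n" for j
      using fps_mult_nth_low_right[of n D j U] that \<open>\<And>i. i < n \<Longrightarrow> fps_nth D i = 0\<close> \<open>fps_nth U 0 = 1\<close> by simp
    then show ?thesis
      using fps_mult_nth_low_left[of n "U * D" i V] that by simp
  qed
  have \<alpha>: "fps_nth \<alpha> i = fps_nth (defect (x + y) z) i + fps_nth (defect x y) i" if "i \<le> n" for i
    using sandwich[of "defect x y" F G i] low that FG0 by (simp add: \<alpha>_def)
  have \<beta>: "fps_nth \<beta> i = fps_nth (defect x (y + z)) i + fps_nth (defect y z) i" if "i \<le> n" for i
    using sandwich[of "defect y z" F' G' i] low that FG0 by (simp add: \<beta>_def)
  have "fps_nth (Q * \<alpha>) n = fps_nth \<alpha> n"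
    using fps_mult_nth_low_right[of n \<alpha> n Q] low FG0 \<alpha> by simp
  moreover have "fps_nth (\<beta> * Q) n = fps_nth \<beta> n"
    using fps_mult_nth_low_left[of n \<beta> n Q] low FG0 \<beta> by simp
  ultimately show ?thesis
    using \<alpha>[of n] \<beta>[of n] QQ by simp
qed

end

section \<open>Operators on functions of words\<close>

text \<open>The transpose of left multiplication by a letter acts on functions of words, and so does the
  transpose of a derivation of the free algebra. Composition is taken in the opposite order, so that
  a word \<open>u\<close> of letters acts on a function \<open>f\<close> with value \<open>f u\<close> at the empty word.\<close>

typedef (overloaded) ('a, 'k) word_op = "{F :: ('a list \<Rightarrow> 'k::field) \<Rightarrow> 'a list \<Rightarrow> 'k.
    (\<forall>f g. F (\<lambda>w. f w + g w) = (\<lambda>w. F f w + F g w)) \<and> (\<forall>c f. F (\<lambda>w. c * f w) = (\<lambda>w. c * F f w))}"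
  morphisms op_apply Abs_word_op
  by (rule exI[of _ "\<lambda>f. f"]) simp

setup_lifting type_definition_word_op

lemma op_apply_linear:
  "op_apply F (\<lambda>w. f w + g w) = (\<lambda>w. op_apply F f w + op_apply F g w)"
  "op_apply F (\<lambda>w. c * f w) = (\<lambda>w. c * op_apply F f w)"
  using op_apply[of F] by auto

lemma op_apply_zero: "op_apply F (\<lambda>w. 0) = (\<lambda>w. 0)"
  using op_apply_linear(2)[of F 0 "\<lambda>w. 0"] by simp

lemma word_op_eqI: "(\<And>f w. op_apply F f w = op_apply G f w) \<Longrightarrow> F = G"
  by (simp add: op_apply_inject[symmetric] fun_eq_iff)

instantiation word_op :: (type, field) ring_1
begin

lift_definition zero_word_op :: "('a, 'b) word_op" is "\<lambda>f w. 0" by simp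
lift_definition one_word_op :: "('a, 'b) word_op" is "\<lambda>f. f" by simp
lift_definition plus_word_op :: "('a, 'b) word_op \<Rightarrow> ('a, 'b) word_op \<Rightarrow> ('a, 'b) word_op"
  is "\<lambda>F G f w. F f w + G f w" by (simp add: algebra_simps)
lift_definition minus_word_op :: "('a, 'b) word_op \<Rightarrow> ('a, 'b) word_op \<Rightarrow> ('a, 'b) word_op"
  is "\<lambda>F G f w. F f w - G f w" by (simp add: algebra_simps)
lift_definition uminus_word_op :: "('a, 'b) word_op \<Rightarrow> ('a, 'b) word_op"
  is "\<lambda>F f w. - F f w" by simp
lift_definition times_word_op :: "('a, 'b) word_op \<Rightarrow> ('a, 'b) word_op \<Rightarrow> ('a, 'b) word_op"
  is "\<lambda>F G f. G (F f)" by simp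

instance
proof
  show "(0 :: ('a, 'b) word_op) \<noteq> 1"
  proof
    assume "(0 :: ('a, 'b) word_op) = 1"
    then have "op_apply (0 :: ('a, 'b) word_op) (\<lambda>w. 1) [] = op_apply 1 (\<lambda>w. 1) []" by simp
    then show False by (simp add: zero_word_op.rep_eq one_word_op.rep_eq)
  qed
qed (rule word_op_eqI; simp add: zero_word_op.rep_eq one_word_op.rep_eq plus_word_op.rep_eq
    minus_word_op.rep_eq uminus_word_op.rep_eq times_word_op.rep_eq op_apply_linear algebra_simps)+

end

lemmas op_apply_simps = zero_word_op.rep_eq one_word_op.rep_eq plus_word_op.rep_eq
    minus_word_op.rep_eq uminus_word_op.rep_eq times_word_op.rep_eq

lemma op_apply_sum: "op_apply (sum F A) f w = (\<Sum>x\<in>A. op_apply (F x) f w)"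
  by (induction A rule: infinite_finite_induct) (auto simp: op_apply_simps)

lift_definition op_scalar :: "'k::field \<Rightarrow> ('a, 'k) word_op" is "\<lambda>c f w. c * f w"
  by (simp add: algebra_simps)

lemma algebra_map_op_scalar: "algebra_map (op_scalar :: 'k::field \<Rightarrow> ('a, 'k) word_op)"
  by standard (rule word_op_eqI; simp add: op_scalar.rep_eq op_apply_simps op_apply_linear algebra_simps)+

lift_definition letter_op :: "'a \<Rightarrow> ('a, 'k::field) word_op" is "\<lambda>a f w. f (a # w)"
  by simp

section \<open>Transposed derivations of the free algebra\<close>

text \<open>The value of \<open>f\<close>, extended linearly, at the derivation applied to a word:
  by the Leibniz rule each letter \<open>a\<close> in turn is replaced by the element whose operator
  is \<open>d a\<close>.\<close>

primrec der_apply :: "('a \<Rightarrow> ('a, 'k::field) word_op) \<Rightarrow> 'a list \<Rightarrow> ('a list \<Rightarrow> 'k) \<Rightarrow> 'k" where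
  "der_apply d [] f = 0"
| "der_apply d (a # w) f = op_apply (d a) f w + der_apply d w (\<lambda>u. f (a # u))"

lift_definition der_op :: "('a \<Rightarrow> ('a, 'k::field) word_op) \<Rightarrow> ('a, 'k) word_op"
  is "\<lambda>d f w. der_apply d w f"
proof (intro conjI allI ext)
  fix d :: "'a \<Rightarrow> ('a, 'k) word_op" and f g :: "'a list \<Rightarrow> 'k" and c :: 'k and w
  show "der_apply d w (\<lambda>w. f w + g w) = der_apply d w f + der_apply d w g"
    by (induction w arbitrary: f g) (simp_all add: op_apply_linear)
  show "der_apply d w (\<lambda>w. c * f w) = c * der_apply d w f"
    by (induction w arbitrary: f) (simp_all add: op_apply_linear algebra_simps)
qed

definition is_der :: "('a, 'k::field) word_op \<Rightarrow> ('a \<Rightarrow> ('a, 'k) word_op) \<Rightarrow> bool" where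
  "is_der D d \<longleftrightarrow> (\<forall>a. D * letter_op a = d a + letter_op a * D) \<and> (\<forall>f. op_apply D f [] = 0)"

lemma is_der_der_op: "is_der (der_op d) d"
  unfolding is_der_def
  by (auto intro!: word_op_eqI simp: op_apply_simps letter_op.rep_eq der_op.rep_eq)

lemma is_der_add: "is_der D d \<Longrightarrow> is_der D' d' \<Longrightarrow> is_der (D + D') (\<lambda>a. d a + d' a)"
  unfolding is_der_def by (simp add: op_apply_simps algebra_simps)

text \<open>The value at a word is the value at the empty word after applying the operators of its
  letters, and \<open>C\<close> can be moved past these.\<close>

lemma eq_0_if_commutes_letters:
  assumes "\<And>a. commutes C (letter_op a)" "\<And>f. op_apply C f [] = 0"
  shows "C = 0"
proof (rule word_op_eqI)
  fix f w
  show "op_apply C f w = op_apply 0 f w"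
  proof (induction w arbitrary: f)
    case (Cons a w)
    have "op_apply C f (a # w) = op_apply (C * letter_op a) f w"
      by (simp add: op_apply_simps letter_op.rep_eq)
    also have "\<dots> = 0"
      by (simp add: assms(1)) (simp add: op_apply_simps Cons.IH)
    finally show ?case by (simp add: op_apply_simps)
  qed (simp add: assms(2) op_apply_simps)
qed

text \<open>The commutator of two derivations is a derivation, so it vanishes once it kills every
  letter; by the Jacobi identity this is what \<open>eq\<close> says.\<close>

lemma is_der_commutes:
  fixes D D' :: "('a, 'k::field) word_op"
  assumes D: "is_der D d" "is_der D' d'"
    and eq: "\<And>a. D * d' a - d' a * D = D' * d a - d a * D'"
  shows "commutes D D'"
proof -
  have "D * D' - D' * D = 0"
  proof (rule eq_0_if_commutes_letters)
    fix a
    let ?l = "letter_op a :: ('a, 'k) word_op"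
    have l: "D * ?l = d a + ?l * D" "D' * ?l = d' a + ?l * D'"
      using D by (auto simp: is_der_def)
    have ll: "D * (D' * ?l) = D * d' a + (D * ?l) * D'" "D' * (D * ?l) = D' * d a + (D' * ?l) * D"
      by (subst l, simp add: distrib_left mult.assoc)+
    have "(D * D' - D' * D) * ?l = D * (D' * ?l) - D' * (D * ?l)"
      by (simp add: algebra_simps)
    also have "\<dots> = D * d' a + (D * ?l) * D' - (D' * d a + (D' * ?l) * D)"
      unfolding ll ..
    also have "\<dots> = (D * d' a - d' a * D) - (D' * d a - d a * D') + ?l * (D * D' - D' * D)"
      unfolding l by (simp add: algebra_simps)
    finally show "commutes (D * D' - D' * D) ?l"
      by (simp add: eq)
  qed (use D in \<open>simp add: op_apply_simps is_der_def\<close>)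
  then show ?thesis by simp
qed

text \<open>The relations of \<open>\<aa>\<^sub>4\<close> force \<open>[t\<^sub>i\<^sub>j, t\<^sub>i\<^sub>4] = [t\<^sub>i\<^sub>4, t\<^sub>j\<^sub>4]\<close> and \<open>[t\<^sub>i\<^sub>j, t\<^sub>k\<^sub>4] = 0\<close>; letter \<open>i\<close> plays the role of \<open>t\<^sub>i\<^sub>4\<close>.\<close>

definition pair_der :: "'a \<Rightarrow> 'a \<Rightarrow> 'a \<Rightarrow> ('a, 'k::field) word_op" where
  "pair_der i j a =
     (if a = i then letter_op i * letter_op j - letter_op j * letter_op i
      else if a = j then letter_op j * letter_op i - letter_op i * letter_op j else 0)"

lemma pair_der_sym: "pair_der i j = pair_der j i"
  by (auto simp: pair_der_def)

definition pair_op :: "'a \<Rightarrow> 'a \<Rightarrow> ('a, 'k::field) word_op" where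
  "pair_op i j = der_op (pair_der i j)"

lemma pair_op_sym: "pair_op i j = pair_op j i"
  by (simp add: pair_op_def pair_der_sym)

lemma pair_op_letter: "pair_op i j * letter_op a = pair_der i j a + letter_op a * pair_op i j"
  using is_der_der_op[of "pair_der i j"] unfolding is_der_def pair_op_def by blast

lemma pair_op_letter_mult:
  "pair_op i j * (letter_op a * F) = pair_der i j a * F + letter_op a * (pair_op i j * F)"
  by (simp add: pair_op_letter distrib_right flip: mult.assoc)

lemma pair_op_commutes:
  assumes "distinct [i, j, k]"
  shows "commutes (pair_op i j) (pair_op i k + pair_op j k :: ('a, 'k::field) word_op)"
proof (rule is_der_commutes)
  show "is_der (pair_op i j) (pair_der i j)"
    unfolding pair_op_def by (rule is_der_der_op)
  show "is_der (pair_op i k + pair_op j k) (\<lambda>a. pair_der i k a + pair_der j k a)"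
    unfolding pair_op_def by (intro is_der_add is_der_der_op)
  fix a
  consider "a = i" | "a = j" | "a = k" | "a \<notin> {i, j, k}" by blast
  then show "pair_op i j * (pair_der i k a + pair_der j k a) - (pair_der i k a + pair_der j k a) * pair_op i j =
      (pair_op i k + pair_op j k) * pair_der i j a - pair_der i j a * (pair_op i k + pair_op j k :: ('a, 'k) word_op)"
    using assms
    by cases (auto simp: pair_der_def[of _ _ i] pair_der_def[of _ _ j] pair_der_def[of _ _ k] pair_der_def[of _ _ a]
        pair_op_letter pair_op_letter_mult algebra_simps)
qed

text \<open>This realises the decomposition of \<aa>\<open>\<^sub>4\<close> into the free Lie
  algebra on \<open>t 1 4\<close>, \<open>t 2 4\<close>, \<open>t 3 4\<close>, acting by letters,
  and the Lie algebra of the first three strands, acting by derivations.\<close>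

lemma a4_family_word_op:
  assumes "distinct [i, j, k]"
  shows "a4_family (six_family (pair_op i j) (pair_op i k) (letter_op i) (pair_op j k)
     (letter_op j) (letter_op k :: ('a, 'k::field) word_op))"
proof (rule a4_family_six)
  show "commutes (pair_op i j) (pair_op i k + pair_op j k :: ('a, 'k) word_op)"
    by (rule pair_op_commutes) (use assms in auto)
  show "commutes (pair_op i k) (pair_op i j + pair_op j k :: ('a, 'k) word_op)"
    using pair_op_commutes[of i k j, where ?'k = 'k] assms by (auto simp: pair_op_sym[of k j])
  show "commutes (pair_op j k) (pair_op i j + pair_op i k :: ('a, 'k) word_op)"
    using pair_op_commutes[of j k i, where ?'k = 'k] assms by (auto simp: pair_op_sym[of k i] pair_op_sym[of j i])
qed (use assms in \<open>auto simp: distrib_left distrib_right pair_op_letter pair_der_def\<close>)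

section \<open>Reading off coefficients\<close>

definition delta_word :: "'a list \<Rightarrow> 'a list \<Rightarrow> 'k::field" where
  "delta_word u = (\<lambda>v. if v = u then 1 else 0)"

definition letters_op :: "'a set \<Rightarrow> ('a, 'k::field) word_op" where
  "letters_op A = (\<Sum>a\<in>A. letter_op a)"

lemma letters_op_delta:
  assumes "finite A"
  shows "op_apply (letters_op A) (delta_word u :: 'a list \<Rightarrow> 'k::field) =
    (case u of [] \<Rightarrow> (\<lambda>w. 0) | a # v \<Rightarrow> if a \<in> A then delta_word v else (\<lambda>w. 0))"
proof (rule ext)
  fix w
  let ?d = "delta_word u :: 'a list \<Rightarrow> 'k"
  have "op_apply (letters_op A) ?d w = (\<Sum>a\<in>A. ?d (a # w))"
    by (simp add: letters_op_def op_apply_sum letter_op.rep_eq)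
  also have "\<dots> = (case u of [] \<Rightarrow> (\<lambda>w. 0) | a # v \<Rightarrow> if a \<in> A then delta_word v else (\<lambda>w. 0)) w"
  proof (cases u)
    case (Cons b v)
    have "(\<Sum>a\<in>A. ?d (a # w)) = (\<Sum>a\<in>A. if a = b then delta_word v w else 0)"
      by (intro sum.cong) (auto simp: Cons delta_word_def)
    then show ?thesis by (simp add: Cons sum.delta assms)
  qed (simp add: delta_word_def)
  finally show "op_apply (letters_op A) ?d w =
    (case u of [] \<Rightarrow> (\<lambda>w. 0) | a # v \<Rightarrow> if a \<in> A then delta_word v else (\<lambda>w. 0)) w" .
qed

lemma wprod_letters_op_delta:
  assumes "\<And>x. finite (A x)"
  shows "op_apply (wprod (\<lambda>x. letters_op (A x)) w) (delta_word u) [] =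
    (if list_all2 (\<lambda>a x. a \<in> A x) u w then 1 else 0)"
proof (induction w arbitrary: u)
  case Nil
  then show ?case by (auto simp: op_apply_simps delta_word_def)
next
  case (Cons x w)
  then show ?case
    by (cases u) (simp_all add: op_apply_simps letters_op_delta[OF assms] op_apply_zero)
qed

text \<open>Substitute the sum of the letters in \<open>A\<close> for X and of those in
  \<open>B\<close> for Y. As \<open>A\<close> and \<open>B\<close> are disjoint, \<open>u\<close>
  arises from at most one word in X and Y, and the test function \<open>delta_word u\<close> picks
  its coefficient.\<close>

lemma ev_letters_op_delta:
  fixes f :: "(xy, 'k::field) ncps"
  assumes "finite A" "finite B" "A \<inter> B = {}" "length u = n"
  shows "op_apply (fps_nth (ev op_scalar f (letters_op A) (letters_op B)) n) (delta_word u) [] =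
    (if set u \<subseteq> A \<union> B then nc_coeff f (map (\<lambda>a. if a \<in> A then LX else LY) u) else 0)"
proof -
  let ?S = "case_xy A B"
  let ?m = "map (\<lambda>a. if a \<in> A then LX else LY) u"
  have S: "finite (?S x)" for x using assms by (auto split: xy.split)
  have th: "case_xy (letters_op A) (letters_op B) = (\<lambda>x. letters_op (?S x) :: ('a, 'k) word_op)"
    by (rule ext) (auto split: xy.split)
  have la: "list_all2 (\<lambda>a x. a \<in> ?S x) u w \<longleftrightarrow> set u \<subseteq> A \<union> B \<and> w = ?m" for w
  proof
    assume "list_all2 (\<lambda>a x. a \<in> ?S x) u w"
    then show "set u \<subseteq> A \<union> B \<and> w = map (\<lambda>a. if a \<in> A then LX else LY) u"
      using assms(3) by (induction rule: list_all2_induct) (auto split: xy.splits)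
  next
    assume "set u \<subseteq> A \<union> B \<and> w = ?m"
    then show "list_all2 (\<lambda>a x. a \<in> ?S x) u w"
      by (auto simp: list_all2_conv_all_nth subset_iff dest: nth_mem)
  qed
  have "op_apply (fps_nth (ev op_scalar f (letters_op A) (letters_op B)) n) (delta_word u) [] =
      (\<Sum>w | length w = n. nc_coeff f w * (if list_all2 (\<lambda>a x. a \<in> ?S x) u w then 1 else 0))"
    unfolding ev_nth th op_apply_sum
    by (simp add: op_apply_simps op_scalar.rep_eq op_apply_linear wprod_letters_op_delta[OF S] cong: if_cong)
  also have "\<dots> = (\<Sum>w | length w = n. if w = ?m then if set u \<subseteq> A \<union> B then nc_coeff f w else 0 else 0)"
    unfolding la by (intro sum.cong) auto
  also have "\<dots> = (if set u \<subseteq> A \<union> B then nc_coeff f ?m else 0)"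
    using assms(4) by (simp add: sum.delta finite_xy_words_eq)
  finally show ?thesis .
qed

section \<open>Vanishing of the hexagon defect\<close>

text \<open>The universal defect, in the free algebra itself: every \<open>defect a b\<close> is an
  evaluation of this one series, so vanishing of its coefficients can be tested in any suitable
  representation.\<close>

definition hex_series :: "'k::field_char_0 \<Rightarrow> (xy, 'k) ncps \<Rightarrow> (xy, 'k) ncps" where
  "hex_series \<mu> \<phi> =
     nc_eval \<phi> (nc_var LX) (- nc_var LX - nc_var LY) * nc_exp (nc_smult (\<mu> / 2) (nc_var LX)) *
     nc_eval \<phi> (nc_var LY) (nc_var LX) * nc_exp (nc_smult (\<mu> / 2) (nc_var LY)) *
     nc_eval \<phi> (- nc_var LX - nc_var LY) (nc_var LY) -
     nc_exp (nc_smult (\<mu> / 2) (nc_var LX + nc_var LY))"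

lemma fps_const_mult_hm: "fps_const c * hm n a = hm n (c * a)"
  by (rule fps_ext) simp

context hexagon_rep
begin

lemma ev_hex_series: "ev sc (hex_series \<mu> \<phi>) a b = defect a b"
proof -
  interpret G: graded_algebra_map_0 sc "\<lambda>_ :: xy. 1" ..
  let ?g = "gev sc (\<lambda>_. 1) (case_xy a b)"
  let ?X = "nc_var LX :: (xy, 'k) ncps" and ?Y = "nc_var LY :: (xy, 'k) ncps"
  have c0: "nc_coeff ?X [] = 0" "nc_coeff ?Y [] = 0" "nc_coeff (- ?X - ?Y) [] = 0" "nc_coeff (?X + ?Y) [] = 0"
    by (simp_all add: nc_var_def nc_coeff_simps)
  have s0: "nc_coeff (nc_smult (\<mu> / 2) f) [] = 0" if "nc_coeff f [] = 0" for f :: "(xy, 'k) ncps"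
    using that by (simp add: nc_smult_def)
  have X: "?g ?X = hm 1 a" and Y: "?g ?Y = hm 1 b"
    using xy.gev_var[of "case_xy a b" LX] xy.gev_var[of "case_xy a b" LY] by simp_all
  have Z: "?g (- ?X - ?Y) = hm 1 (- a - b)" and S: "?g (?X + ?Y) = hm 1 (a + b)"
    by (simp_all only: xy.gev_diff xy.gev_minus xy.gev_add X Y hm_diff hm_minus hm_add)
  have e: "?g (nc_exp (nc_smult (\<mu> / 2) f)) = E c" if "?g f = hm 1 c" "nc_coeff f [] = 0" for f c
    unfolding E_def using that s0
    by (intro G.gev_nc_exp) (simp_all only: xy.gev_smult fps_const_mult_hm)
  show ?thesis
    unfolding ev_def hex_series_def defect_def hex_def xy.gev_diff xy.gev_mult
      e[OF X c0(1)] e[OF Y c0(2)] e[OF S c0(4)]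
      xy.gev_nc_eval[OF c0(1,3) X Z] xy.gev_nc_eval[OF c0(2,1) Y X] xy.gev_nc_eval[OF c0(3,2) Z Y] ..
qed

lemma defect_nth: "fps_nth (defect a b) n =
    (\<Sum>w | length w = n. sc (nc_coeff (hex_series \<mu> \<phi>) w) * wprod (case_xy a b) w)"
  by (simp add: ev_nth flip: ev_hex_series)

lemma defect_commuting: "commutes a b \<Longrightarrow> defect a b = E a * E b - E (a + b)"
  unfolding defect_def hex_def by (simp add: p_commuting algebra_simps)

end

section \<open>The part of degree 2\<close>

lemma words_1: "{w :: xy list. length w = 1} = {[LX], [LY]}"
  by (auto simp: length_Suc_conv) (metis xy.exhaust)

lemma words_2: "{w :: xy list. length w = 2} = {[LX, LX], [LX, LY], [LY, LX], [LY, LY]}"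
  by (auto simp: length_Suc_conv numeral_2_eq_2) (metis xy.exhaust)+

context pentagon_rep
begin

lemma phi_power: "n > 0 \<Longrightarrow> nc_coeff \<phi> (replicate n LX) = 0" "n > 0 \<Longrightarrow> nc_coeff \<phi> (replicate n LY) = 0"
  using power_coeffs_eq_0[OF group_like pentagon] by blast+

lemma phi_2: "nc_coeff \<phi> [LX, LX] = 0" "nc_coeff \<phi> [LY, LY] = 0"
  using phi_power[of 2] by (simp_all add: numeral_2_eq_2)

lemma phi_YX: "nc_coeff \<phi> [LY, LX] = - c2 \<phi>"
proof -
  interpret K: pentagon_rep "\<lambda>x :: 'k. x" \<phi>
    by (intro pentagon_rep.intro algebra_map_id pentagon_rep_axioms.intro group_like pentagon)
  \<comment> \<open>\<phi>(1, 1) = 1, so the coefficients of \<phi> in degree 2 add up to 0.\<close>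
  have "fps_nth (K.p 1 1) 2 = 0" by (simp add: K.p_commuting)
  then show ?thesis
    using phi_2 by (simp add: ev_nth words_2 c2_def add_eq_0_iff)
qed

lemma p_nth_1: "fps_nth (p a b) 1 = 0"
  unfolding ev_nth words_1 using phi_power[of 1] by (simp add: sc_zero)

lemma p_nth_2: "fps_nth (p a b) 2 = sc (c2 \<phi>) * (a * b - b * a)"
  unfolding ev_nth words_2 using phi_2 phi_YX
  by (simp add: sc_zero sc_minus right_diff_distrib flip: c2_def)

end

context hexagon_rep
begin

text \<open>Each of the three \<phi>-factors contributes -\<open>c2 \<phi>\<close> times
  [\<open>a\<close>, \<open>b\<close>]. The exponentials contribute \<mu>^2/4 times
  \<open>a * b\<close> and the squares, which leaves \<mu>^2/8 times
  [\<open>a\<close>, \<open>b\<close>] after subtracting \<open>E (a + b)\<close>.\<close>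

lemma defect_nth_2: "fps_nth (defect a b) 2 = sc (\<mu> ^ 2 / 8 - 3 * c2 \<phi>) * (a * b - b * a)"
proof -
  define s q g where "s = sc (\<mu> / 2)" and "q = sc (\<mu> ^ 2 / 8)" and "g = sc (c2 \<phi>)"
  have E1: "fps_nth (E c) 1 = s * c" and E2: "fps_nth (E c) 2 = q * c ^ 2" for c
    by (simp_all add: E_nth s_def q_def power2_eq_square)
  have s: "s * s = q + q"
    unfolding s_def q_def by (simp add: power2_eq_square flip: sc_mult sc_add)
  have ss: "(s * a) * (s * b) = q * (a * b) + q * (a * b)"
  proof -
    have "(s * a) * (s * b) = (s * s) * (a * b)"
      unfolding s_def by (simp add: mult.assoc sc_left_commute[of a])
    then show ?thesis by (simp add: s distrib_right)
  qed
  have three: "sc (3 * c) = sc c + sc c + sc c" for c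
    by (simp flip: sc_add)
  have n2: "fps_nth (F * G) 2 = fps_nth F 0 * fps_nth G 2 + fps_nth F 1 * fps_nth G 1 + fps_nth F 2 * fps_nth G 0"
    for F G :: "'r fps"
    by (simp add: fps_mult_nth numeral_2_eq_2)
  have n1: "fps_nth (F * G) 1 = fps_nth F 0 * fps_nth G 1 + fps_nth F 1 * fps_nth G 0" for F G :: "'r fps"
    by (simp add: fps_mult_nth)
  have n0: "fps_nth (F * G) 0 = fps_nth F 0 * fps_nth G 0" for F G :: "'r fps"
    by (simp add: fps_mult_nth)
  have "fps_nth (defect a b) 2 = g * (a * (- a - b) - (- a - b) * a) + g * (b * a - a * b) +
      g * ((- a - b) * b - b * (- a - b)) + q * a ^ 2 + q * b ^ 2 + (s * a) * (s * b) - q * (a + b) ^ 2"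
    by (simp only: defect_def hex_def fps_sub_nth n2 n1 n0 E1 E2 E_nth_0 p_nth_0 p_nth_1 p_nth_2
        mult_1_left mult_1_right mult_zero_left mult_zero_right add_0_left add_0_right flip: g_def)
      (simp add: algebra_simps)
  also have "\<dots> = (q - (g + g + g)) * (a * b - b * a)"
    unfolding ss by (simp add: algebra_simps power2_eq_square)
  finally show ?thesis
    by (simp add: q_def g_def sc_diff three)
qed

end

context
  fixes \<phi> :: "(xy, 'k::field_char_0) ncps" and \<mu> :: 'k
  assumes gl: "group_like \<phi>" and pent: "pentagon \<phi>"
begin

abbreviation defect_coeff :: "xy list \<Rightarrow> 'k" where
  "defect_coeff \<equiv> nc_coeff (hex_series \<mu> \<phi>)"

lemma hexagon_repI: "algebra_map sc \<Longrightarrow> hexagon_rep sc \<phi>"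
  by (intro hexagon_rep.intro pentagon_rep.intro pentagon_rep_axioms.intro gl pent)

lemma letter_op_eq: "letter_op a = letters_op {a}"
  by (simp add: letters_op_def)

lemma defect_coeff_XY: "defect_coeff [LX, LY] = \<mu> ^ 2 / 8 - 3 * c2 \<phi>"
proof -
  interpret hexagon_rep "op_scalar :: 'k \<Rightarrow> (xy, 'k) word_op" \<phi> \<mu>
    by (rule hexagon_repI[OF algebra_map_op_scalar])
  let ?v = "\<lambda>F. op_apply F (delta_word [LX, LY]) [] :: 'k"
  have "?v (fps_nth (defect (letter_op LX) (letter_op LY)) 2) = \<mu> ^ 2 / 8 - 3 * c2 \<phi>"
    unfolding defect_nth_2 by (simp add: op_apply_simps op_scalar.rep_eq letter_op.rep_eq delta_word_def)
  moreover have "?v (fps_nth (defect (letter_op LX) (letter_op LY)) 2) = defect_coeff [LX, LY]"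
    unfolding ev_hex_series[symmetric] letter_op_eq by (subst ev_letters_op_delta) simp_all
  ultimately show ?thesis by simp
qed

text \<open>Evaluation at X = Y = 1 in the field, where everything commutes: the \<phi>-factors
  become 1 and the exponentials cancel.\<close>

lemma sum_defect_coeff: "(\<Sum>w | length w = n. defect_coeff w) = 0"
proof -
  interpret hexagon_rep "\<lambda>x :: 'k. x" \<phi> \<mu>
    by (rule hexagon_repI[OF algebra_map_id])
  have E: "E a = fps_exp (\<mu> / 2 * a)" for a
    by (rule fps_ext) (simp add: E_nth power_mult_distrib power_divide)
  have "defect 1 1 = 0"
    by (simp add: defect_commuting E flip: fps_exp_add_mult)
  then have "fps_nth (defect 1 1) n = 0" by simp
  moreover have "wprod (case_xy 1 1) w = (1 :: 'k)" for w
    by (induction w) (auto split: xy.split)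
  ultimately show ?thesis by (simp add: defect_nth)
qed

section \<open>The cocycle identity for coefficients\<close>

text \<open>The coefficient at \<open>u\<close> of the defect series with the sum of the letters in
  \<open>A\<close> substituted for X and that of the letters in \<open>B\<close> for Y; letter i
  stands for \<open>t i 4\<close>.\<close>

definition merged_coeff :: "4 set \<Rightarrow> 4 set \<Rightarrow> 4 list \<Rightarrow> 'k" where
  "merged_coeff A B u =
     (if set u \<subseteq> A \<union> B then defect_coeff (map (\<lambda>a. if a \<in> A then LX else LY) u) else 0)"

lemma merged_coeff_cocycle:
  assumes low: "\<And>w. length w < length u \<Longrightarrow> defect_coeff w = 0"
  shows "merged_coeff {1, 2} {3} u + merged_coeff {1} {2} u =
    merged_coeff {1} {2, 3} u + merged_coeff {2} {3} u"
proof -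
  interpret hexagon_rep "op_scalar :: 'k \<Rightarrow> (4, 'k) word_op" \<phi> \<mu>
    by (rule hexagon_repI[OF algebra_map_op_scalar])
  let ?l = "letter_op :: 4 \<Rightarrow> (4, 'k) word_op"
  let ?n = "length u"
  let ?v = "\<lambda>F. op_apply F (delta_word u) [] :: 'k"
  have low': "fps_nth (defect a b) i = 0" if "i < ?n" for a b i
    unfolding defect_nth using low that by (simp add: sc_zero)
  have v: "?v (fps_nth (defect (letters_op A) (letters_op B)) ?n) = merged_coeff A B u"
    if "A \<inter> B = {}" for A B
    unfolding ev_hex_series[symmetric] merged_coeff_def using that
    by (subst ev_letters_op_delta) simp_all
  have l: "?l 1 + ?l 2 = letters_op {1, 2}" "?l 2 + ?l 3 = letters_op {2, 3}"
    by (simp_all add: letters_op_def)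
  have "fps_nth (defect (?l 1 + ?l 2) (?l 3)) ?n + fps_nth (defect (?l 1) (?l 2)) ?n =
      fps_nth (defect (?l 1) (?l 2 + ?l 3)) ?n + fps_nth (defect (?l 2) (?l 3)) ?n"
    using defect_cocycle[OF a4_family_word_op[of 1 2 3] low'] by simp
  then have "?v (fps_nth (defect (letters_op {1, 2}) (letters_op {3})) ?n + fps_nth (defect (letters_op {1}) (letters_op {2})) ?n) =
      ?v (fps_nth (defect (letters_op {1}) (letters_op {2, 3})) ?n + fps_nth (defect (letters_op {2}) (letters_op {3})) ?n)"
    unfolding l unfolding letter_op_eq by (rule arg_cong)
  then show ?thesis
    unfolding plus_word_op.rep_eq by (simp add: v)
qed

context
  fixes n :: nat
  assumes low: "\<And>w. length w < n \<Longrightarrow> defect_coeff w = 0"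
begin

lemma defect_coeff_constant:
  assumes "n > 0"
  shows "defect_coeff (replicate n x) = 0"
proof (cases x)
  case LX
  \<comment> \<open>At the word 1...1 two terms on the left and one on the right equal the
    coefficient, so it is 0. At the word 3...3 it occurs once on the left and twice on the
    right.\<close>
  show ?thesis
    using merged_coeff_cocycle[of "replicate n 1"] low assms LX by (simp add: merged_coeff_def)
next
  case LY
  show ?thesis
    using merged_coeff_cocycle[of "replicate n 3"] low assms LY by (simp add: merged_coeff_def)
qed

lemma defect_coeff_flip:
  assumes w: "length w = n" "i < n" "j < n" "k < n" "w ! i = LX" "w ! j = LY" "k \<noteq> i" "k \<noteq> j"
  shows "defect_coeff (w[k := x]) = defect_coeff (w[k := y])"
proof -
  \<comment> \<open>The cocycle identity at a word with letter 2 in position \<open>k\<close>: it contains 1 and 3 as well, so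
    that only the terms merging 2 with 1 and 2 with 3 survive.\<close>
  define u where "u = (map (\<lambda>x. (case x of LX \<Rightarrow> 1 | LY \<Rightarrow> 3) :: 4) w)[k := 2]"
  have len: "length u = n" using w by (simp add: u_def)
  have "u ! i = 1" "u ! j = 3" "u ! k = 2"
    using w by (simp_all add: u_def)
  then have mem: "1 \<in> set u" "3 \<in> set u" "2 \<in> set u"
    using len w by (metis nth_mem)+
  have sub: "set u \<subseteq> {1, 2, 3}"
    using set_update_subset_insert[of "map (\<lambda>x. (case x of LX \<Rightarrow> 1 | LY \<Rightarrow> 3) :: 4) w" k 2]
    by (auto simp: u_def split: xy.splits)
  have m1: "map (\<lambda>a. if a \<in> {1, 2} then LX else LY) u = w[k := LX]"
    unfolding u_def map_update by (auto simp: map_idI split: xy.split intro!: arg_cong[where f = "\<lambda>l. l[k := LX]"])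
  have m2: "map (\<lambda>a. if a \<in> {1} then LX else LY) u = w[k := LY]"
    unfolding u_def map_update by (auto simp: map_idI split: xy.split intro!: arg_cong[where f = "\<lambda>l. l[k := LY]"])
  have nsub: "\<not> set u \<subseteq> {1} \<union> {2}" "\<not> set u \<subseteq> {2} \<union> {3}" "set u \<subseteq> {1, 2} \<union> {3}" "set u \<subseteq> {1} \<union> {2, 3}"
    using mem sub by auto
  have "defect_coeff (w[k := LX]) = defect_coeff (w[k := LY])"
    using merged_coeff_cocycle[of u] low len unfolding merged_coeff_def m1 m2 by (simp only: nsub) simp
  then show ?thesis by (cases x; cases y) auto
qed

text \<open>Positions other than \<open>i\<close>, \<open>j\<close> can be flipped one after another.\<close>

lemma defect_coeff_eq_if_agree:
  assumes len: "length w = n" "length w' = n" "i < n" "j < n"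
    and ij: "w ! i = LX" "w ! j = LY" "w' ! i = LX" "w' ! j = LY"
  shows "defect_coeff w = defect_coeff w'"
proof -
  have "defect_coeff w = defect_coeff (take m w' @ drop m w)" if "m \<le> n" for m
    using that
  proof (induction m)
    case (Suc m)
    define v where "v = take m w' @ drop m w"
    have nth: "v ! l = (if l < m then w' ! l else w ! l)" if "l < n" for l
      using that len Suc.prems by (simp add: v_def nth_append)
    have lv: "length v = n" using len Suc.prems by (simp add: v_def)
    have eq: "take (Suc m) w' @ drop (Suc m) w = v[m := w' ! m]"
      by (rule nth_equalityI) (use len lv Suc.prems nth in \<open>auto simp: nth_append nth_list_update less_Suc_eq\<close>)
    have "defect_coeff (v[m := v ! m]) = defect_coeff (v[m := w' ! m])"
    proof (cases "m = i \<or> m = j")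
      case True
      then show ?thesis using nth[of m] ij Suc.prems by auto
    next
      case False
      then show ?thesis
        using defect_coeff_flip[of v i j m] lv nth ij len Suc.prems by auto
    qed
    then show ?case using Suc eq v_def by simp
  qed simp
  from this[of n] show ?thesis using len by simp
qed

text \<open>Fixing one X and one Y, all other positions are free. This links \<open>w\<close> to the
  word \<open>e i\<close> with a single X, and \<open>e i\<close> to \<open>e 0\<close> through a
  word with X at both 0 and \<open>i\<close>.\<close>

lemma defect_coeff_nonconstant:
  assumes n: "n \<ge> 3" and w: "length w = n" "w \<noteq> replicate n LX" "w \<noteq> replicate n LY"
  shows "defect_coeff w = defect_coeff ((replicate n LY)[0 := LX])"
proof -
  define e where "e i = (replicate n LY)[i := LX]" for i
  have e_nth: "e i ! j = (if j = i then LX else LY)" if "i < n" "j < n" for i j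
    using that by (simp add: e_def)
  have e_len: "length (e i) = n" for i by (simp add: e_def)
  obtain i where i: "i < n" "w ! i \<noteq> LY"
    using w(1,3) by (metis in_set_conv_nth replicate_eqI)
  obtain j where j: "j < n" "w ! j \<noteq> LX"
    using w(1,2) by (metis in_set_conv_nth replicate_eqI)
  have ij: "w ! i = LX" "w ! j = LY"
    using i j by (metis xy.exhaust)+
  then have "i \<noteq> j" by auto
  have "defect_coeff w = defect_coeff (e i)"
    using i j ij \<open>i \<noteq> j\<close> w by (intro defect_coeff_eq_if_agree[of _ _ i j]) (auto simp: e_nth e_len)
  also have "\<dots> = defect_coeff (e 0)"
  proof (cases "i = 0")
    case False
    \<comment> \<open>A third position, which exists since \<open>n\<close> is at least 3; it keeps
      the letter Y while 0 and \<open>i\<close> change.\<close>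
    define k where "k = (if i = 1 then 2 else 1 :: nat)"
    have k: "k < n" "k \<noteq> i" "k \<noteq> 0" using n by (auto simp: k_def)
    define v where "v = (e i)[0 := LX]"
    have v: "length v = n" "v ! i = LX" "v ! 0 = LX" "v ! k = LY"
      using i n k False by (auto simp: v_def e_nth e_len nth_list_update)
    have "defect_coeff v = defect_coeff (e i)"
      using v i k by (intro defect_coeff_eq_if_agree[of _ _ i k]) (auto simp: e_nth e_len)
    moreover have "defect_coeff v = defect_coeff (e 0)"
      using v n k by (intro defect_coeff_eq_if_agree[of _ _ 0 k]) (auto simp: e_nth e_len)
    ultimately show ?thesis by simp
  qed simp
  finally show ?thesis by (simp add: e_def)
qed

end

text \<open>Induction on the length, so that the cocycle identity is available in the lowest degree
  that is still open. The value of \<mu>^2 enters in degree 2.\<close>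

lemma defect_coeff_eq_0:
  assumes mu: "\<mu> ^ 2 = 24 * c2 \<phi>"
  shows "defect_coeff w = 0"
proof (induction "length w" arbitrary: w rule: less_induct)
  case less
  define n where "n = length w"
  have low: "defect_coeff v = 0" if "length v < n" for v
    using less that by (simp add: n_def)
  note const_0 = defect_coeff_constant[OF low]
  consider "n = 0" | "n = 1" | "n = 2" | "n \<ge> 3" by linarith
  then show ?case
  proof cases
    case 1
    then show ?thesis using sum_defect_coeff[of 0] by (simp add: n_def)
  next
    case 2
    then have "w \<in> {[LX], [LY]}" using words_1 by (auto simp: n_def)
    then show ?thesis using const_0 2 by force
  next
    case 3
    then have w: "w \<in> {[LX, LX], [LX, LY], [LY, LX], [LY, LY]}" using words_2 by (auto simp: n_def)
    have XY: "defect_coeff [LX, LY] = 0" using mu by (simp add: defect_coeff_XY)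
    have c: "defect_coeff [LX, LX] = 0" "defect_coeff [LY, LY] = 0"
      using const_0[of n] 3 by (simp_all add: numeral_2_eq_2)
    have "defect_coeff [LY, LX] = 0"
      using sum_defect_coeff[of 2] XY c by (simp add: words_2)
    then show ?thesis using w XY c by auto
  next
    case 4
    define c where "c = defect_coeff ((replicate n LY)[0 := LX])"
    let ?N = "{v :: xy list. length v = n \<and> v \<noteq> replicate n LX \<and> v \<noteq> replicate n LY}"
    have fin: "finite ?N" by (rule finite_subset[OF _ finite_xy_words_eq[of n]]) auto
    have N: "defect_coeff v = c" if "v \<in> ?N" for v
      using defect_coeff_nonconstant[OF low 4] that by (simp add: c_def)
    have const: "defect_coeff (replicate n x) = 0" for x
      using const_0[of n] 4 by simp
    have "0 = (\<Sum>v | length v = n. defect_coeff v)" by (simp add: sum_defect_coeff)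
    also have "\<dots> = (\<Sum>v\<in>?N. defect_coeff v)"
    proof (rule sum.mono_neutral_right)
      show "\<forall>v\<in>{v. length v = n} - ?N. defect_coeff v = 0"
        using const by (metis (mono_tags, lifting) DiffE mem_Collect_eq)
    qed (auto simp: finite_xy_words_eq)
    \<comment> \<open>All non-constant words share the coefficient \<open>c\<close>; their number is
      not 0 in characteristic 0, as the word XY...Y is among them.\<close>
    also have "\<dots> = of_nat (card ?N) * c" by (simp add: N)
    finally have "card ?N = 0 \<or> c = 0" by simp
    moreover have "(replicate n LY)[0 := LX] ! 0 = LX" "(replicate n LY)[0 := LX] ! 1 = LY"
      using 4 by auto
    then have "(replicate n LY)[0 := LX] \<in> ?N"
      using 4 by (auto dest!: arg_cong[where f = "\<lambda>v. (v ! 0, v ! 1)"])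
    ultimately have "c = 0" using fin by (metis (no_types, lifting) card_0_eq empty_iff)
    then show ?thesis
      using N[of w] const n_def by (metis (mono_tags, lifting) mem_Collect_eq)
  qed
qed

end

section \<open>The completed enveloping algebra as a ring\<close>

lemma a4_ideal:
  fixes f g :: "(4 \<times> 4, 'k::field) env_series"
  defines "I \<equiv> env_ideal a4_relators"
  shows "0 \<in> I" "f \<in> I \<Longrightarrow> g \<in> I \<Longrightarrow> f + g \<in> I" "f \<in> I \<Longrightarrow> f * g \<in> I" "f \<in> I \<Longrightarrow> g * f \<in> I"
    "f \<in> I \<Longrightarrow> - f \<in> I" "f \<in> I \<Longrightarrow> g \<in> I \<Longrightarrow> f - g \<in> I"
proof -
  note ci = closed_ideal_env_ideal[of "a4_relators :: (4 \<times> 4, 'k) nonassoc set", folded I_def, unfolded closed_ideal_def]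
  note add = ci[THEN conjunct2, THEN conjunct1, rule_format]
  note mult = ci[THEN conjunct2, THEN conjunct2, THEN conjunct1, rule_format]
  show "0 \<in> I" by (rule ci[THEN conjunct1])
  show "f \<in> I \<Longrightarrow> g \<in> I \<Longrightarrow> f + g \<in> I" by (rule add)
  show "f \<in> I \<Longrightarrow> f * g \<in> I" "f \<in> I \<Longrightarrow> g * f \<in> I" using mult by simp_all
  have minus: "- h \<in> I" if "h \<in> I" for h
    using mult[OF that, of "- 1"] by simp
  show "f \<in> I \<Longrightarrow> - f \<in> I" by (rule minus)
  show "f \<in> I \<Longrightarrow> g \<in> I \<Longrightarrow> f - g \<in> I"
    using add[of f "- g"] minus[of g] by simp
qed

lemma Ua4_eq_refl: "x \<doteq> x"
  by (simp add: Ua4_eq_def a4_ideal)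

lemma equivp_Ua4_eq: "equivp (Ua4_eq :: (4 \<times> 4, 'k::field) env_series \<Rightarrow> _)"
proof (rule equivpI)
  show "reflp (Ua4_eq :: (4 \<times> 4, 'k) env_series \<Rightarrow> _)" by (simp add: reflp_def Ua4_eq_refl)
  show "symp (Ua4_eq :: (4 \<times> 4, 'k) env_series \<Rightarrow> _)"
  proof (rule sympI)
    fix x y :: "(4 \<times> 4, 'k) env_series" assume "x \<doteq> y"
    then show "y \<doteq> x" unfolding Ua4_eq_def using a4_ideal(5)[of "x - y"] by simp
  qed
  show "transp (Ua4_eq :: (4 \<times> 4, 'k) env_series \<Rightarrow> _)"
  proof (rule transpI)
    fix x y z :: "(4 \<times> 4, 'k) env_series" assume "x \<doteq> y" "y \<doteq> z"
    then show "x \<doteq> z" unfolding Ua4_eq_def using a4_ideal(2)[of "x - y" "y - z"] by simp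
  qed
qed

\<comment> \<open>As a type of class \<open>ring_1\<close> the quotient can serve as target of the
  evaluations above.\<close>
quotient_type (overloaded) 'k Ua4 = "(4 \<times> 4, 'k::field) env_series" / Ua4_eq
  by (rule equivp_Ua4_eq)

instantiation Ua4 :: (field) ring_1
begin

lift_definition zero_Ua4 :: "'a Ua4" is 0 .
lift_definition one_Ua4 :: "'a Ua4" is 1 .
lift_definition plus_Ua4 :: "'a Ua4 \<Rightarrow> 'a Ua4 \<Rightarrow> 'a Ua4" is "(+)"
  unfolding Ua4_eq_def by (simp add: a4_ideal(2) add_diff_add)
lift_definition minus_Ua4 :: "'a Ua4 \<Rightarrow> 'a Ua4 \<Rightarrow> 'a Ua4" is "(-)"
proof -
  fix x x' y y' :: "(4 \<times> 4, 'a) env_series"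
  assume "x \<doteq> x'" "y \<doteq> y'"
  moreover have "x - y - (x' - y') = (x - x') - (y - y')" by simp
  ultimately show "x - y \<doteq> x' - y'" unfolding Ua4_eq_def by (simp only: a4_ideal(6))
qed
lift_definition uminus_Ua4 :: "'a Ua4 \<Rightarrow> 'a Ua4" is uminus
  unfolding Ua4_eq_def by (simp only: a4_ideal(5) minus_diff_minus)
lift_definition times_Ua4 :: "'a Ua4 \<Rightarrow> 'a Ua4 \<Rightarrow> 'a Ua4" is "(*)"
proof -
  fix x x' y y' :: "(4 \<times> 4, 'a) env_series"
  assume "x \<doteq> x'" "y \<doteq> y'"
  moreover have "x * y - x' * y' = (x - x') * y + x' * (y - y')" by (simp add: algebra_simps)
  ultimately show "x * y \<doteq> x' * y'" unfolding Ua4_eq_def by (simp only: a4_ideal(2,3,4))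
qed

instance
proof
  show "(0 :: 'a Ua4) \<noteq> 1"
  proof transfer
    interpret algebra_map "\<lambda>x :: 'a. x" by standard (auto simp: mult.commute)
    \<comment> \<open>The augmentation, sending all generators to 0, separates 0 from 1.\<close>
    interpret a4_rep "\<lambda>x :: 'a. x" "\<lambda>_ _. 0" by standard (simp add: a4_family_def)
    show "\<not> (0 :: (4 \<times> 4, 'a) env_series) \<doteq> 1"
      using a4_eval_cong[of 0 1] by (auto simp: env.gev_0 env.gev_1)
  qed
qed (transfer; simp add: algebra_simps Ua4_eq_refl)+

end

lemma abs_Ua4_eq_iff: "abs_Ua4 x = abs_Ua4 y \<longleftrightarrow> x \<doteq> y"
  by (rule Ua4.abs_eq_iff)

lemma abs_Ua4_sum: "abs_Ua4 (sum f A) = (\<Sum>x\<in>A. abs_Ua4 (f x))"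
  by (induction A rule: infinite_finite_induct) (auto simp flip: zero_Ua4_def plus_Ua4.abs_eq)

definition Ua4_scalar :: "'k::field \<Rightarrow> 'k Ua4" where
  "Ua4_scalar c = abs_Ua4 (nc_smult c 1)"

lemma nc_smult_1_mult: "nc_smult c 1 * f = nc_smult c f" "f * nc_smult c 1 = nc_smult (c :: 'k::field) f"
proof -
  have 1: "nc_smult c 1 * f = nc_smult c (1 * f)" and 2: "f * nc_smult c 1 = nc_smult c (f * 1)"
    by (rule ncps_eqI; simp add: nc_coeff_mult nc_smult_def sum_distrib_left mult_ac del: mult_1_left mult_1_right)+
  show "nc_smult c 1 * f = nc_smult c f" "f * nc_smult c 1 = nc_smult c f"
    using 1 2 by simp_all
qed

lemma algebra_map_Ua4_scalar: "algebra_map (Ua4_scalar :: 'k::field \<Rightarrow> 'k Ua4)"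
proof
  fix a b :: 'k and x :: "'k Ua4"
  show "Ua4_scalar (a + b) = Ua4_scalar a + Ua4_scalar b"
    unfolding Ua4_scalar_def plus_Ua4.abs_eq
    by (intro arg_cong[of _ _ abs_Ua4] ncps_eqI) (simp add: nc_smult_def nc_coeff_simps distrib_right)
  show "Ua4_scalar (a * b) = Ua4_scalar a * Ua4_scalar b"
    unfolding Ua4_scalar_def times_Ua4.abs_eq nc_smult_1_mult
    by (intro arg_cong[of _ _ abs_Ua4] ncps_eqI) (simp add: nc_smult_def mult.assoc)
  show "Ua4_scalar (1 :: 'k) = 1"
    unfolding Ua4_scalar_def one_Ua4_def by simp
  show "Ua4_scalar a * x = x * Ua4_scalar a"
    by (induction x) (simp add: Ua4_scalar_def times_Ua4.abs_eq nc_smult_1_mult)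
qed

definition Ua4_t :: "4 \<Rightarrow> 4 \<Rightarrow> 'k::field Ua4" where
  "Ua4_t i j = abs_Ua4 (t i j)"

lemma abs_Ua4_bracket:
  "abs_Ua4 (env_of_lie (na_bracket p q)) =
   abs_Ua4 (env_of_lie p) * abs_Ua4 (env_of_lie q) - abs_Ua4 (env_of_lie q) * abs_Ua4 (env_of_lie p)"
  unfolding times_Ua4.abs_eq minus_Ua4.abs_eq abs_Ua4_eq_iff Ua4_eq_def
  by (rule env_ideal_generators(2))

lemma abs_Ua4_relator:
  assumes "p \<in> a4_relators"
  shows "abs_Ua4 (env_of_lie p) = 0"
proof -
  have "p \<in> lie_ideal a4_relators"
    unfolding lie_ideal_def using assms by (simp add: hull_inc)
  then have "env_of_lie p \<in> env_ideal a4_relators"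
    using env_ideal_generators(1) by blast
  then show ?thesis
    unfolding zero_Ua4_def abs_Ua4_eq_iff Ua4_eq_def by simp
qed

lemma a4_family_Ua4_t: "a4_family (Ua4_t :: 4 \<Rightarrow> 4 \<Rightarrow> 'k::field Ua4)"
  unfolding a4_family_def
proof (intro conjI allI impI)
  fix i j k l :: 4
  have t: "Ua4_t i j = abs_Ua4 (env_of_lie (t_lie i j :: (4 \<times> 4, 'k) nonassoc))" for i j
    by (simp add: Ua4_t_def t_def)
  have add: "abs_Ua4 (env_of_lie (p + q)) = abs_Ua4 (env_of_lie p) + abs_Ua4 (env_of_lie q)"
    for p q :: "(4 \<times> 4, 'k) nonassoc"
    by (simp add: env_of_lie_add plus_Ua4.abs_eq)
  show "Ua4_t i i = (0 :: 'k Ua4)"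
    unfolding t by (rule abs_Ua4_relator) (auto simp: a4_relators_def)
  have "abs_Ua4 (env_of_lie (t_lie i j - t_lie j i :: (4 \<times> 4, 'k) nonassoc)) = 0"
    by (rule abs_Ua4_relator) (auto simp: a4_relators_def)
  then show "Ua4_t i j = (Ua4_t j i :: 'k Ua4)"
    by (simp add: t env_of_lie_diff flip: minus_Ua4.abs_eq)
  show "commutes (Ua4_t i j) (Ua4_t i k + Ua4_t j k :: 'k Ua4)" if "distinct [i, j, k]"
  proof -
    have "abs_Ua4 (env_of_lie (na_bracket (t_lie i j) (t_lie i k + t_lie j k :: (4 \<times> 4, 'k) nonassoc))) = 0"
      using that by (intro abs_Ua4_relator) (auto simp: a4_relators_def)
    then show ?thesis by (simp add: t abs_Ua4_bracket add)
  qed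
  show "commutes (Ua4_t i j) (Ua4_t k l :: 'k Ua4)" if "distinct [i, j, k, l]"
  proof -
    have "abs_Ua4 (env_of_lie (na_bracket (t_lie i j) (t_lie k l :: (4 \<times> 4, 'k) nonassoc))) = 0"
      using that by (intro abs_Ua4_relator) (unfold a4_relators_def, blast)
    then show ?thesis by (simp add: t abs_Ua4_bracket)
  qed
qed

text \<open>In the quotient the letter \<open>Br x y\<close> equals the commutator of the letters
  \<open>x\<close> and \<open>y\<close>, so evaluation at the generators returns the class of each
  letter.\<close>

lemma magma_eval_Ua4_t: "magma_eval (case_prod Ua4_t) x = abs_Ua4 (nc_var x)"
proof (induction x)
  case (Gen g)
  then show ?case by (cases g) (simp add: Ua4_t_def t_eq_var)
next
  case (Br x y)
  have 1: "env_of_lie (Poly_Mapping.single x 1) = nc_var x" for x :: "(4 \<times> 4) magma"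
    by (simp add: env_of_lie_single)
  have "env_of_lie (na_bracket (Poly_Mapping.single x 1) (Poly_Mapping.single y (1 :: 'a))) = nc_var (Br x y)"
    by (simp add: env_of_lie_bracket)
  then show ?case
    using Br abs_Ua4_bracket[of "Poly_Mapping.single x (1 :: 'a)" "Poly_Mapping.single y 1"] by (simp add: 1)
qed

lemma nc_coeff_wprod_var: "nc_coeff (wprod nc_var w) v = (if v = w then 1 else 0 :: 'k::field)"
proof (induction w arbitrary: v)
  case (Cons x w)
  have "nc_coeff (wprod nc_var (x # w)) v =
      (\<Sum>i\<le>length v. if i = 1 then if v = x # w then 1 else 0 else (0 :: 'k))"
    unfolding wprod_simps nc_coeff_mult Cons.IH
    by (intro sum.cong refl) (cases v, auto simp: nc_var_def take_Cons' drop_Cons' split: if_splits)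
  then show ?case by (auto simp: sum.delta)
qed (simp add: nc_coeff_simps)

interpretation Ua4: a4_rep "Ua4_scalar :: 'k::field \<Rightarrow> 'k Ua4" Ua4_t
  by (intro a4_rep.intro algebra_map_Ua4_scalar a4_rep_axioms.intro a4_family_Ua4_t)

text \<open>The class of the homogeneous part \<open>h n\<close> is the \<open>n\<close>-th
  coefficient of the evaluation, so every \<open>h n\<close> lies in the ideal. The partial sums
  approximate \<open>f\<close>, and the ideal is closed.\<close>

lemma env_ideal_if_Ua4_eval_eq_0:
  assumes "Ua4.a4_eval f = 0"
  shows "f \<in> env_ideal a4_relators"
proof -
  let ?I = "env_ideal a4_relators :: (4 \<times> 4, 'a) env_series set"
  let ?W = "\<lambda>n. {w. wdeg magma_degree w = n} :: (4 \<times> 4) magma list set"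
  define h where "h n = (\<Sum>w\<in>?W n. nc_smult (nc_coeff f w) (wprod nc_var w))" for n
  have h_coeff: "nc_coeff (h n) v = (if wdeg magma_degree v = n then nc_coeff f v else 0)" for n v
    unfolding h_def nc_coeff_sum nc_smult_def nc_coeff_Abs nc_coeff_wprod_var
    by (simp add: if_distrib[where f = "\<lambda>x. _ * x"] sum.delta Ua4.env.finite_words cong: if_cong)
  have w: "wprod (magma_eval (case_prod Ua4_t)) w = abs_Ua4 (wprod nc_var w)" for w :: "(4 \<times> 4) magma list"
    by (induction w) (simp_all add: magma_eval_Ua4_t times_Ua4.abs_eq one_Ua4_def)
  have "abs_Ua4 (h n) = fps_nth (Ua4.a4_eval f) n" for n
    unfolding h_def abs_Ua4_sum Ua4.env.gev_nth w Ua4_scalar_def times_Ua4.abs_eq nc_smult_1_mult ..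
  then have h: "h n \<in> ?I" for n
    using assms by (simp add: zero_Ua4_def abs_Ua4_eq_iff Ua4_eq_def)
  have H: "(\<Sum>m\<le>n. h m) \<in> ?I" for n
    by (induction n) (auto intro: h a4_ideal(2))
  have "nc_coeff f w = nc_coeff (\<Sum>m\<le>n. h m) w" if "word_degree w \<le> n" for w n
    using that by (simp add: nc_coeff_sum h_coeff sum.delta wdeg_magma_degree cong: if_cong)
  then show ?thesis
    using H closed_ideal_env_ideal[of "a4_relators :: (4 \<times> 4, 'a) nonassoc set"]
    unfolding closed_ideal_def by blast
qed

lemma Ua4_eq_iff: "x \<doteq> y \<longleftrightarrow> Ua4.a4_eval x = Ua4.a4_eval y"
  using env_ideal_if_Ua4_eval_eq_0[of "x - y"] Ua4.a4_eval_cong[of x y]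
  by (auto simp: Ua4.env.gev_diff Ua4_eq_def)

section \<open>The hexagon equations\<close>

locale a4_hexagon = hexagon_rep sc \<phi> \<mu> + a4_rep sc \<tau>
  for sc :: "'k::field_char_0 \<Rightarrow> 'r::ring_1" and \<phi> :: "(xy, 'k) ncps" and \<mu> and \<tau>
begin

lemma a4_eval_exp:
  assumes "nc_coeff A [] = 0" "a4_eval A = hm 1 \<alpha>"
  shows "a4_eval (nc_exp (nc_smult (\<mu> / 2) A)) = E \<alpha>"
proof -
  interpret G: graded_algebra_map_0 sc "magma_degree :: (4 \<times> 4) magma \<Rightarrow> nat" ..
  show ?thesis
    unfolding E_def using assms
    by (intro G.gev_nc_exp) (simp_all only: env.gev_smult fps_const_mult_hm, simp add: nc_smult_def)
qed

lemma a4_eval_phi: "a4_eval (nc_eval \<phi> (t i j) (t k l)) = p (\<tau> i j) (\<tau> k l)"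
  by (rule a4_eval_nc_eval) (simp_all only: nc_coeff_t_Nil a4_eval_t)

text \<open>By \<open>p_swap\<close>, exchanging the arguments of \<phi> gives the inverse.\<close>

lemma a4_eval_inv_phi: "a4_eval (nc_inv (nc_eval \<phi> (t i j) (t k l))) = p (\<tau> k l) (\<tau> i j)"
proof -
  let ?f = "nc_eval \<phi> (t i j) (t k l)"
  have inv: "?f * nc_inv ?f = 1"
    using nc_inverse_exists[of ?f] by (simp add: nc_coeff_nc_eval_Nil phi_Nil)
  have 1: "p (\<tau> i j) (\<tau> k l) * a4_eval (nc_inv ?f) = 1"
    unfolding a4_eval_phi[symmetric] env.gev_mult[symmetric] inv by (rule env.gev_1)
  have "p (\<tau> k l) (\<tau> i j) * (p (\<tau> i j) (\<tau> k l) * a4_eval (nc_inv ?f)) = a4_eval (nc_inv ?f)"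
    by (simp add: p_swap flip: mult.assoc)
  then show ?thesis
    unfolding 1 by simp
qed

lemma a4_central:
  assumes "distinct [i, j, k]"
  shows "commutes (\<tau> i j + \<tau> i k + \<tau> j k) (\<tau> i j)"
  using a4_familyD(2)[OF a4 assms] by (simp add: distrib_left distrib_right add.assoc)

lemma a4_eval_hexagon:
  "a4_eval (nc_exp (nc_smult (\<mu> / 2) (t 1 3 + t 2 3))) = E (\<tau> 1 3 + \<tau> 2 3)"
  "a4_eval (nc_eval \<phi> (t 1 3) (t 1 2) * nc_exp (nc_smult (\<mu> / 2) (t 1 3)) *
     nc_inv (nc_eval \<phi> (t 1 3) (t 2 3)) * nc_exp (nc_smult (\<mu> / 2) (t 2 3)) *
     nc_eval \<phi> (t 1 2) (t 2 3)) = hex (\<tau> 1 3) (\<tau> 2 3)"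
  "a4_eval (nc_exp (nc_smult (\<mu> / 2) (t 1 2 + t 1 3))) = E (\<tau> 1 2 + \<tau> 1 3)"
  "a4_eval (nc_inv (nc_eval \<phi> (t 2 3) (t 1 3)) * nc_exp (nc_smult (\<mu> / 2) (t 1 3)) *
     nc_eval \<phi> (t 1 2) (t 1 3) * nc_exp (nc_smult (\<mu> / 2) (t 1 2)) *
     nc_inv (nc_eval \<phi> (t 1 2) (t 2 3))) = hex (\<tau> 1 3) (\<tau> 1 2)"
proof -
  have sy: "\<tau> 2 1 = \<tau> 1 2" "\<tau> 3 1 = \<tau> 1 3" "\<tau> 3 2 = \<tau> 2 3"
    by (rule a4_familyD(1)[OF a4])+
  \<comment> \<open>This sum is central in the subalgebra generated by the three elements, as
    \<open>hex_eq\<close> demands.\<close>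
  define c where "c = \<tau> 1 2 + \<tau> 1 3 + \<tau> 2 3"
  have c: "commutes c (\<tau> 1 2)" "commutes c (\<tau> 1 3)" "commutes c (\<tau> 2 3)"
    using a4_central[of 1 2 3] a4_central[of 1 3 2] a4_central[of 2 3 1]
    unfolding c_def sy by (simp_all only: add_ac distinct.simps simp_thms list.set empty_iff insert_iff) auto
  have t: "a4_eval (t i j) = hm 1 (\<tau> i j)" "nc_coeff (t i j) [] = (0 :: 'k)"
    "nc_coeff (t i j + t k l) [] = (0 :: 'k)" for i j k l
    by (simp_all only: a4_eval_t nc_coeff_t_Nil nc_coeff_simps add_0_left)
  note ex = a4_eval_exp[OF t(2,1)] a4_eval_exp[OF t(3) a4_eval_t_add]
  show "a4_eval (nc_exp (nc_smult (\<mu> / 2) (t 1 3 + t 2 3))) = E (\<tau> 1 3 + \<tau> 2 3)"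
    "a4_eval (nc_exp (nc_smult (\<mu> / 2) (t 1 2 + t 1 3))) = E (\<tau> 1 2 + \<tau> 1 3)"
    by (rule ex)+
  show "a4_eval (nc_eval \<phi> (t 1 3) (t 1 2) * nc_exp (nc_smult (\<mu> / 2) (t 1 3)) *
     nc_inv (nc_eval \<phi> (t 1 3) (t 2 3)) * nc_exp (nc_smult (\<mu> / 2) (t 2 3)) *
     nc_eval \<phi> (t 1 2) (t 2 3)) = hex (\<tau> 1 3) (\<tau> 2 3)"
    unfolding env.gev_mult ex a4_eval_phi a4_eval_inv_phi
    by (rule hex_eq[of c, symmetric]) (simp_all add: c, simp add: c_def add_ac)
  show "a4_eval (nc_inv (nc_eval \<phi> (t 2 3) (t 1 3)) * nc_exp (nc_smult (\<mu> / 2) (t 1 3)) *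
     nc_eval \<phi> (t 1 2) (t 1 3) * nc_exp (nc_smult (\<mu> / 2) (t 1 2)) *
     nc_inv (nc_eval \<phi> (t 1 2) (t 2 3))) = hex (\<tau> 1 3) (\<tau> 1 2)"
    unfolding env.gev_mult ex a4_eval_phi a4_eval_inv_phi
    by (rule hex_eq[of c, symmetric]) (simp_all add: c, simp add: c_def add_ac)
qed

end

text \<open>The first hexagon equation determines \<mu>^2 in degree 2, by its coefficient at XY in
  an action on words. Conversely, with this \<mu>^2 all defects vanish, and both equations are
  instances of \<open>hex a b\<close> = \<open>E (a + b)\<close>.\<close>

lemma hexagons_iff:
  fixes \<phi> :: "(xy, 'k::field_char_0) ncps"
  assumes gl: "group_like \<phi>" and pent: "pentagon \<phi>"
  shows "hexagon1 \<mu> \<phi> \<and> hexagon2 \<mu> \<phi> \<longleftrightarrow> \<mu> ^ 2 = 24 * c2 \<phi>"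
proof
  assume "hexagon1 \<mu> \<phi> \<and> hexagon2 \<mu> \<phi>"
  then have hex: "hexagon1 \<mu> \<phi>" by simp
  let ?x = "letter_op LX :: (xy, 'k) word_op" and ?y = "letter_op LY :: (xy, 'k) word_op"
  \<comment> \<open>Strand 4 is forgotten and the sum of the other three generators is sent to 0,
    which leaves a free algebra on two letters.\<close>
  let ?\<tau> = "six_family (- ?x - ?y) ?x 0 ?y 0 0"
  interpret hexagon_rep "op_scalar :: 'k \<Rightarrow> (xy, 'k) word_op" \<phi> \<mu>
    by (rule hexagon_repI[OF gl pent algebra_map_op_scalar])
  interpret a4_hexagon "op_scalar :: 'k \<Rightarrow> (xy, 'k) word_op" \<phi> \<mu> ?\<tau>
    by unfold_locales (rule a4_family_six; simp add: algebra_simps)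
  have "hex ?x ?y = E (?x + ?y)"
    using a4_eval_cong[OF hex[unfolded hexagon1_def]] unfolding a4_eval_hexagon by simp
  then have "defect ?x ?y = 0" by (simp add: defect_def)
  moreover have "op_apply (fps_nth (defect ?x ?y) 2) (delta_word [LX, LY]) [] = \<mu> ^ 2 / 8 - 3 * c2 \<phi>"
    unfolding defect_nth_2 by (simp add: op_apply_simps op_scalar.rep_eq letter_op.rep_eq delta_word_def)
  ultimately have "\<mu> ^ 2 / 8 - 3 * c2 \<phi> = 0"
    by (simp add: op_apply_simps)
  then show "\<mu> ^ 2 = 24 * c2 \<phi>" by (simp add: field_simps)
next
  assume mu: "\<mu> ^ 2 = 24 * c2 \<phi>"
  interpret hexagon_rep "Ua4_scalar :: 'k \<Rightarrow> 'k Ua4" \<phi> \<mu>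
    by (rule hexagon_repI[OF gl pent algebra_map_Ua4_scalar])
  interpret a4_hexagon "Ua4_scalar :: 'k \<Rightarrow> 'k Ua4" \<phi> \<mu> Ua4_t
    by unfold_locales
  have "defect a b = 0" for a b
    by (rule fps_ext) (simp add: defect_nth defect_coeff_eq_0[OF gl pent mu] Ua4.sc_zero)
  then have "hex a b = E (a + b)" for a b
    by (simp add: defect_def)
  then show "hexagon1 \<mu> \<phi> \<and> hexagon2 \<mu> \<phi>"
    unfolding hexagon1_def hexagon2_def Ua4_eq_iff a4_eval_hexagon by (simp add: add.commute)
qed

section \<open>Passage to the algebraic closure\<close>

lemma to_ac_Delta_word: "to_ac (Delta_word u uv) = Delta_word u uv"
proof (induction u arbitrary: uv)
  case Nil
  then show ?case by (auto simp: tensor_def nc_coeff_simps split: prod.splits)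
next
  case (Cons z u)
  obtain v w where uv: "uv = (v, w)" by fastforce
  show ?case
    unfolding uv Delta_word_Cons by (auto simp: Cons.IH split: list.splits)
qed

lemma nc_coeff_nc_map [simp]: "nc_coeff (nc_map h f) w = h (nc_coeff f w)"
  by (simp add: nc_map_def)

lemma group_like_to_ac:
  assumes "group_like \<phi>"
  shows "group_like (nc_map to_ac \<phi>)"
proof -
  have "Delta (nc_map to_ac \<phi>) (v, w) = tensor (nc_map to_ac \<phi>) (nc_map to_ac \<phi>) (v, w)" for v w
  proof -
    have "Delta (nc_map to_ac \<phi>) (v, w) = to_ac (Delta \<phi> (v, w))"
      by (simp add: Delta_eq_sum to_ac_sum to_ac_Delta_word)
    then show ?thesis using assms by (simp add: group_like_def tensor_def)
  qed
  then show ?thesis using assms by (auto simp: group_like_def)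
qed

text \<open>Over \<open>k\<close>, the pentagon equation can be evaluated in \<open>U\<aa>\<^sub>4\<close> over the algebraic closure, which
  is an algebra over \<open>k\<close> as well.\<close>

lemma pentagon_to_ac:
  fixes \<phi> :: "(xy, 'k::field) ncps"
  assumes "pentagon \<phi>"
  shows "pentagon (nc_map to_ac \<phi>)"
proof -
  let ?sc = "\<lambda>c :: 'k. Ua4_scalar (to_ac c)"
  have ev: "ev Ua4_scalar (nc_map to_ac \<phi>) = ev ?sc \<phi>"
    by (intro ext fps_ext) (simp add: ev_nth)
  interpret A: a4_rep ?sc Ua4_t
    by standard
       (rule Ua4.sc_central a4_family_Ua4_t | simp add: Ua4.sc_add Ua4.sc_mult Ua4.sc_one)+
  show ?thesis
    unfolding pentagon_def Ua4_eq_iff Ua4.a4_eval_pentagon ev by (rule A.pentagon_ev[OF assms])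
qed

theorem theorem1:
  fixes \<phi> :: "(xy, 'k::field_char_0) ncps"
  assumes "group_like \<phi>" and "pentagon \<phi>"
  shows "\<exists>\<mu> :: 'k alg_closure.
    (\<forall>\<nu>. hexagon1 \<nu> (nc_map to_ac \<phi>) \<and> hexagon2 \<nu> (nc_map to_ac \<phi>) \<longleftrightarrow> \<nu> = \<mu> \<or> \<nu> = - \<mu>) \<and>
    \<mu> ^ 2 = to_ac (24 * c2 \<phi>)"
proof -
  \<comment> \<open>A square root exists in the algebraic closure; the solutions of \<nu>^2 =
    \<mu>^2 are then \<mu> and -\<mu>.\<close>
  obtain \<mu> :: "'k alg_closure" where \<mu>: "\<mu> ^ 2 = to_ac (24 * c2 \<phi>)"
    using nth_root_exists[of 2] by auto
  have "hexagon1 \<nu> (nc_map to_ac \<phi>) \<and> hexagon2 \<nu> (nc_map to_ac \<phi>) \<longleftrightarrow> \<nu> = \<mu> \<or> \<nu> = - \<mu>" for \<nu>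
  proof -
    have "hexagon1 \<nu> (nc_map to_ac \<phi>) \<and> hexagon2 \<nu> (nc_map to_ac \<phi>) \<longleftrightarrow> \<nu> ^ 2 = \<mu> ^ 2"
      using hexagons_iff[OF group_like_to_ac[OF assms(1)] pentagon_to_ac[OF assms(2)], of \<nu>] \<mu>
      by (simp add: c2_def)
    then show ?thesis by (simp add: power2_eq_iff)
  qed
  with \<mu> show ?thesis by blast
qed

end
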